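(* Let $\Omega \subseteq \mathbb{C}^{n}$ be an open set (in the Euclidean topology). Then the pluri-fine topology on $\Omega$ is locally connected.
   Context: The pluri-fine topology on a Euclidean open set $\Omega \subseteq \mathbb{C}^n$ is the coarsest topology on $\Omega$ making all plurisubharmonic functions $\varphi : \Omega \to [-\infty,\infty)$ continuous. "Locally connected" is meant in the usual topological sense: every neighbourhood of every point contains a connected open neighbourhood of that point, where all notions refer to the pluri-fine topology. *)

theory Defs
  imports "HOL-Analysis.Analysis"
begin

definition usc_on :: "'a::topological_space set \<Rightarrow> ('a \<Rightarrow> ereal) \<Rightarrow> bool" where
  "usc_on S u \<longleftrightarrow> (\<forall>c. openin (top_of_set S) {x \<in> S. u x < c})"

text \<open>
  The mean \<open>(1 / 2\<pi>) \<integral>\<^sub>0\<^sup>2\<^sup>\<pi> u (c + r e\<^sup>i\<^sup>t) dt\<close> of an extended-real function,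
  as the integral of the positive part minus that of the negative part
  (\<open>e2ennreal\<close> sends negative values to \<open>0\<close>).
  If \<open>u\<close> is upper semicontinuous and \<open>< \<infinity>\<close> on the circle, it is Borel and
  bounded above there, so the first integral is finite and the difference is
  the genuine integral, possibly \<open>-\<infinity>\<close>.
\<close>
definition circle_mean :: "(complex \<Rightarrow> ereal) \<Rightarrow> complex \<Rightarrow> real \<Rightarrow> ereal" where
  "circle_mean u c r =
     (enn2ereal (\<integral>\<^sup>+ t\<in>{0..2*pi}. e2ennreal (u (c + of_real r * cis t)) \<partial>lborel)
      - enn2ereal (\<integral>\<^sup>+ t\<in>{0..2*pi}. e2ennreal (- u (c + of_real r * cis t)) \<partial>lborel))
     / ereal (2 * pi)"

text \<open>
  The function that is identically \<open>-\<infinity>\<close>, on all of \<open>S\<close> or on some of its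
  components, counts as subharmonic.
\<close>
definition subharmonic_on :: "complex set \<Rightarrow> (complex \<Rightarrow> ereal) \<Rightarrow> bool" where
  "subharmonic_on S u \<longleftrightarrow>
     usc_on S u \<and> (\<forall>z\<in>S. u z < \<infinity>) \<and>
     (\<forall>c r. 0 < r \<longrightarrow> cball c r \<subseteq> S \<longrightarrow> u c \<le> circle_mean u c r)"

definition plurisubharmonic_on :: "(complex ^ 'n) set \<Rightarrow> (complex ^ 'n \<Rightarrow> ereal) \<Rightarrow> bool" where
  "plurisubharmonic_on \<Omega> \<phi> \<longleftrightarrow>
     usc_on \<Omega> \<phi> \<and> (\<forall>z\<in>\<Omega>. \<phi> z < \<infinity>) \<and>
     (\<forall>a b. subharmonic_on {\<zeta>. a + \<zeta> *s b \<in> \<Omega>} (\<lambda>\<zeta>. \<phi> (a + \<zeta> *s b)))"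

definition pluri_fine_topology :: "(complex ^ 'n) set \<Rightarrow> (complex ^ 'n) topology" where
  "pluri_fine_topology \<Omega> =
     topology_generated_by {{z \<in> \<Omega>. \<phi> z \<in> U} | \<phi> U. plurisubharmonic_on \<Omega> \<phi> \<and> open U}"

lemma plurisubharmonic_on_0: "plurisubharmonic_on \<Omega> (\<lambda>z. 0)"
proof -
  have usc: "usc_on S (\<lambda>z. 0)" for S :: "'b::topological_space set"
    unfolding usc_on_def
  proof
    fix c :: ereal
    show "openin (top_of_set S) {x \<in> S. 0 < c}"
      by (cases "0 < c") simp_all
  qed
  have mean: "circle_mean (\<lambda>z. 0) c r = 0" for c r
    by (simp add: circle_mean_def zero_ennreal.rep_eq flip: zero_ennreal_def)
  show ?thesis
    by (simp add: plurisubharmonic_on_def subharmonic_on_def usc mean)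
qed

lemma topspace_pluri_fine_topology [simp]: "topspace (pluri_fine_topology \<Omega>) = \<Omega>"
proof
  show "topspace (pluri_fine_topology \<Omega>) \<subseteq> \<Omega>"
    unfolding pluri_fine_topology_def topology_generated_by_topspace by blast
  have "\<Omega> = {z \<in> \<Omega>. (\<lambda>z. 0::ereal) z \<in> UNIV}" by simp
  then have "\<Omega> \<in> {{z \<in> \<Omega>. \<phi> z \<in> U} | \<phi> U. plurisubharmonic_on \<Omega> \<phi> \<and> open U}"
    using plurisubharmonic_on_0[of \<Omega>] open_UNIV by blast
  then show "\<Omega> \<subseteq> topspace (pluri_fine_topology \<Omega>)"
    unfolding pluri_fine_topology_def topology_generated_by_topspace by (rule Union_upper)
qed

lemma continuous_map_pluri_fine:
  assumes "plurisubharmonic_on \<Omega> \<phi>"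
  shows "continuous_map (pluri_fine_topology \<Omega>) euclidean \<phi>"
  unfolding continuous_map_def
proof (intro conjI allI impI)
  fix U :: "ereal set" assume "openin euclidean U"
  then have "openin (pluri_fine_topology \<Omega>) {z \<in> \<Omega>. \<phi> z \<in> U}"
    unfolding pluri_fine_topology_def using assms
    by (intro topology_generated_by_Basis) auto
  then show "openin (pluri_fine_topology \<Omega>) {z \<in> topspace (pluri_fine_topology \<Omega>). \<phi> z \<in> U}"
    by simp
qed auto

lemma pluri_fine_topology_coarsest:
  assumes "topspace T = \<Omega>"
    and cont: "\<And>\<phi>. plurisubharmonic_on \<Omega> \<phi> \<Longrightarrow> continuous_map T euclidean \<phi>"
    and "openin (pluri_fine_topology \<Omega>) W"
  shows "openin T W"
proof -
  have "generate_topology_on {{z \<in> \<Omega>. \<phi> z \<in> U} | \<phi> U. plurisubharmonic_on \<Omega> \<phi> \<and> open U} W"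
    using assms(3) by (simp add: pluri_fine_topology_def openin_topology_generated_by_iff)
  then show ?thesis
  proof induction
    case (Basis s)
    then obtain \<phi> U where "s = {z \<in> \<Omega>. \<phi> z \<in> U}" "plurisubharmonic_on \<Omega> \<phi>" "open U"
      by auto
    then show ?case
      using cont[of \<phi>] assms(1) by (auto simp: continuous_map_def)
  qed auto
qed

end

theory Submission
  imports Defs "HOL-Complex_Analysis.Cauchy_Integral_Formula"
begin

text \<open>
  Near a point \<open>z\<close>, a pluri-fine neighbourhood contains \<open>{v < 1}\<close> for some plurisuperharmonic
  \<open>v \<ge> 0\<close> on a ball with \<open>v z\<close> as small as we like. On a complex line, smallness of \<open>v\<close> at \<open>x\<close>
  prevents \<open>{v \<ge> 1}\<close> from meeting all rays from \<open>x\<close> whose directions fill an arc (compare \<open>v\<close>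
  with a potential that is large at \<open>x\<close>). So if \<open>v\<close> is small at two points, rays from them can
  be chosen in \<open>{v < 1}\<close> that cross, and the points are joined in \<open>{v < 1}\<close> by two segments.

  A segment covered by two disjoint finely open sets lies in one of them. Indeed, the crossing
  argument shows that points of different sets cannot be close compared to the sizes of their
  neighbourhoods; by Baire's theorem the common boundary then contains a portion inside one of
  the two sets, and an end point of a complementary interval contradicts the fact that a segment
  is not thin at its end points.

  Hence in an open set \<open>W\<close> all points near \<open>z\<close> lie in the quasi-component of \<open>z\<close>, so
  quasi-components of \<open>W\<close> are open and coincide with the components.
\<close>

section \<open>The kernel \<open>1 / sqrt |z|\<close>\<close>

lemma holomorphic_circle_mean_has_integral:
  fixes f :: "complex \<Rightarrow> complex"
  assumes "f holomorphic_on cball c r" "0 < r"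
  shows "((\<lambda>t. f (c + of_real r * cis t)) has_integral of_real (2*pi) * f c) {0..2*pi}"
proof -
  have "((\<lambda>u. f u / (u - c)) has_contour_integral 2 * of_real pi * \<i> * f c) (part_circlepath c r 0 (2*pi))"
    using Cauchy_integral_circlepath_simple[OF assms(1), of c] assms(2) by (simp add: circlepath_def)
  then have "((\<lambda>t. f (c + of_real r * cis t) / (of_real r * cis t) * of_real r * \<i> * cis t)
      has_integral 2 * of_real pi * \<i> * f c) {0..2*pi}"
    by (simp add: has_contour_integral_part_circlepath_iff)
  then have "((\<lambda>t. f (c + of_real r * cis t) * \<i>) has_integral 2 * of_real pi * \<i> * f c) {0..2*pi}"
    using assms(2) by (simp add: field_simps)
  from has_integral_mult_left[OF this, of "-\<i>"]
  show ?thesis by (simp add: mult.assoc mult.left_commute[of \<i>])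
qed

lemma norm_holomorphic_le_circle_mean:
  fixes f :: "complex \<Rightarrow> complex"
  assumes "f holomorphic_on cball c r" "0 < r"
  shows "2*pi * cmod (f c) \<le> integral {0..2*pi} (\<lambda>t. cmod (f (c + of_real r * cis t)))"
proof -
  have *: "continuous_on {0..2*pi} (\<lambda>t. f (c + of_real r * cis t))"
    using assms by (intro continuous_on_compose2[OF holomorphic_on_imp_continuous_on[OF assms(1)]] continuous_intros)
       (auto simp: dist_norm norm_mult)
  have "norm (integral {0..2*pi} (\<lambda>t. f (c + of_real r * cis t))) \<le> integral {0..2*pi} (\<lambda>t. cmod (f (c + of_real r * cis t)))"
    by (intro integral_norm_bound_integral integrable_continuous_real continuous_intros *) auto
  then show ?thesis
    using integral_unique[OF holomorphic_circle_mean_has_integral[OF assms]] by (simp add: norm_mult)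
qed

text \<open>The disc does not contain \<open>w\<close>, so \<open>1 / sqrt (z - w)\<close> has a
  holomorphic branch on it, and the modulus of a holomorphic function satisfies the sub-mean value
  inequality.\<close>

lemma inverse_sqrt_kernel_submean:
  fixes w c :: complex
  assumes "0 < r" "w \<notin> cball c r"
  shows "2*pi * (1 / sqrt (cmod (c - w))) \<le> integral {0..2*pi} (\<lambda>t. 1 / sqrt (cmod (c + of_real r * cis t - w)))"
proof -
  have cw: "cmod (c - w) > r" using assms by (simp add: dist_norm)
  then have cz: "c \<noteq> w" using assms by auto
  \<comment> \<open>Dividing by \<open>c - w\<close> before taking \<open>Ln\<close> puts the image
    of the disc into the right half-plane, away from the branch cut.\<close>
  define f where "f z = exp (- Ln ((z - w)/(c - w)) / 2) / csqrt (c - w)" for z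
  have ne: "(z - w)/(c - w) \<notin> \<real>\<^sub>\<le>\<^sub>0" if "z \<in> cball c r" for z
  proof -
    have "(z - w)/(c - w) = 1 + (z - c)/(c - w)" using cz by (simp add: field_simps)
    moreover have "cmod ((z - c)/(c - w)) < 1"
      using that cw cz by (simp add: norm_divide dist_norm norm_minus_commute divide_less_eq_1)
    then have "\<bar>Re ((z - c)/(c - w))\<bar> < 1" using abs_Re_le_cmod order_le_less_trans by blast
    ultimately have "Re ((z - w)/(c - w)) > 0" by simp
    then show ?thesis using complex_nonpos_Reals_iff by force
  qed
  have zw: "z - w \<noteq> 0" if "z \<in> cball c r" for z using that assms by auto
  have hol: "f holomorphic_on cball c r"
    unfolding f_def by (intro holomorphic_intros) (use ne cz in auto)
  have nf: "cmod (f z) = 1 / sqrt (cmod (z - w))" if z: "z \<in> cball c r" for z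
  proof -
    have n: "(z - w)/(c - w) \<noteq> 0" using zw[OF z] cz by simp
    have "(cmod (f z))\<^sup>2 = cmod ((f z)\<^sup>2)" by (simp add: norm_power)
    also have "(f z)\<^sup>2 = exp (- Ln ((z - w)/(c - w))) / (c - w)"
      by (simp add: f_def power_divide flip: exp_double)
    also have "\<dots> = 1 / (z - w)" using n cz by (simp add: exp_minus)
    finally have "(cmod (f z))\<^sup>2 = 1 / cmod (z - w)" by (simp add: norm_divide)
    then show ?thesis by (metis norm_ge_zero real_sqrt_divide real_sqrt_one real_sqrt_unique)
  qed
  have "integral {0..2*pi} (\<lambda>t. cmod (f (c + of_real r * cis t))) = integral {0..2*pi} (\<lambda>t. 1 / sqrt (cmod (c + of_real r * cis t - w)))"
    by (intro integral_cong nf) (use assms in \<open>auto simp: dist_norm norm_mult\<close>)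
  with norm_holomorphic_le_circle_mean[OF hol assms(1)] nf[of c] assms(1) show ?thesis by simp
qed

text \<open>A discrete form of the integrability of \<open>1 / sqrt |y|\<close> in one dimension:
  each term is at most 5/2 times an increment of the square root, and the increments telescope. The
  bound does not depend on \<open>x\<close>.\<close>

lemma sum_inverse_sqrt_dist_le:
  fixes x :: real
  shows "(\<Sum>j<N. 1 / sqrt (max 1 \<bar>real j - x\<bar>)) \<le> 5 * sqrt (real N)"
proof -
  \<comment> \<open>The square root continued by 0. As \<open>h\<close> is monotone, the two
    telescoping sums, one for \<open>j \<ge> x\<close> and one for \<open>j < x\<close>, can be
    added: the summand of the wrong side is nonnegative.\<close>
  define h where "h y = sqrt (max 0 y)" for y :: real
  have hm: "h a \<le> h b" if "a \<le> b" for a b using that by (simp add: h_def)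
  have hs: "h a - h b \<le> sqrt (a - b)" if "b \<le> a" for a b
  proof -
    have "max 0 a \<le> max 0 b + (a - b)" using that by simp
    then have "sqrt (max 0 a) \<le> sqrt (max 0 b + (a-b))" by simp
    also have "\<dots> \<le> sqrt (max 0 b) + sqrt (a - b)" using that by (intro sqrt_add_le_add_sqrt) auto
    finally show ?thesis by (simp add: h_def)
  qed
  \<comment> \<open>\<open>sqrt (y+1) - sqrt y\<close> is the reciprocal of
    \<open>sqrt (y+1) + sqrt y\<close>, which is at most
    \<open>(sqrt 2 + 1) * sqrt (max 1 y)\<close>; 5/2 bounds \<open>sqrt 2 + 1\<close>.\<close>
  have key: "1 / sqrt (max 1 y) \<le> 5/2 * (h (y+1) - h y)" if "y \<ge> 0" for y
  proof -
    define m where "m = max 1 y"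
    have m: "m \<ge> 1" "y \<le> m" by (auto simp: m_def)
    have "sqrt (y+1) + sqrt y \<le> sqrt (2*m) + sqrt m"
      using m that by (intro add_mono) auto
    also have "\<dots> = (sqrt 2 + 1) * sqrt m" by (simp add: real_sqrt_mult algebra_simps)
    also have "\<dots> \<le> 5/2 * sqrt m"
    proof -
      have "sqrt 2 \<le> 3/2" by (rule real_le_lsqrt) (auto simp: power2_eq_square)
      then show ?thesis using m by (intro mult_right_mono) auto
    qed
    finally have A: "sqrt (y+1) + sqrt y \<le> 5/2 * sqrt m" .
    have B: "(sqrt (y+1) - sqrt y) * (sqrt (y+1) + sqrt y) = 1"
      using that by (simp add: algebra_simps flip: power2_eq_square)
    have nn: "sqrt (y+1) - sqrt y \<ge> 0" by simp
    have "1 \<le> (sqrt (y+1) - sqrt y) * (5/2 * sqrt m)"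
      using mult_left_mono[OF A nn] B by simp
    then show ?thesis using m that by (simp add: h_def field_simps flip: m_def)
  qed
  have t: "1 / sqrt (max 1 \<bar>real j - x\<bar>) \<le> 5/2 * (h (real (Suc j) - x) - h (real j - x)) + 5/2 * (h (x - real j + 1) - h (x - real (Suc j) + 1))" for j
  proof (cases "real j \<ge> x")
    case True
    then show ?thesis using key[of "real j - x"] hm[of "x - real j" "x - real j + 1"]
      by (simp add: algebra_simps)
  next
    case False
    then show ?thesis using key[of "x - real j"] hm[of "real j - x" "real j - x + 1"]
      by (simp add: algebra_simps)
  qed
  have "(\<Sum>j<N. 1 / sqrt (max 1 \<bar>real j - x\<bar>)) \<le> (\<Sum>j<N. 5/2 * (h (real (Suc j) - x) - h (real j - x)) + 5/2 * (h (x - real j + 1) - h (x - real (Suc j) + 1)))"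
    by (intro sum_mono t)
  also have "\<dots> = 5/2 * (h (real N - x) - h (real 0 - x)) + 5/2 * (h (x - real 0 + 1) - h (x - real N + 1))"
    unfolding sum.distrib sum_distrib_left[symmetric]
    by (simp only: sum_lessThan_telescope[of "\<lambda>j. h (real j - x)"] sum_lessThan_telescope'[of "\<lambda>j. h (x - real j + 1)"])
  also have "\<dots> \<le> 5/2 * sqrt (real N) + 5/2 * sqrt (real N)"
    using hs[of "real 0 - x" "real N - x"] hs[of "x - real N + 1" "x - real 0 + 1"]
    by (intro add_mono mult_left_mono) simp_all
  finally show ?thesis by simp
qed

section \<open>Superharmonic functions of one variable\<close>

text \<open>Otherwise the sets where \<open>w\<close> exceeds one of its values \<open>w y\<close>
  form an open cover of \<open>K\<close>; a finite subcover misses the index point with the least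
  value.\<close>

lemma compact_lsc_attains_inf:
  fixes w :: "'a::topological_space \<Rightarrow> 'b::linorder"
  assumes "compact K" "K \<noteq> {}"
    and lsc: "\<And>c. openin (top_of_set K) {x \<in> K. c < w x}"
  obtains x where "x \<in> K" "\<And>y. y \<in> K \<Longrightarrow> w x \<le> w y"
proof (rule ccontr)
  assume "\<not> thesis"
  then have ex: "\<forall>x\<in>K. \<exists>y\<in>K. w y < w x"
    using that by (meson not_le)
  define \<C> where "\<C> = (\<lambda>y. {x \<in> K. w y < w x}) ` K"
  have "K \<subseteq> \<Union>\<C>" using ex by (fastforce simp: \<C>_def)
  moreover have "\<forall>c\<in>\<C>. openin (top_of_set K) c" using lsc by (auto simp: \<C>_def)
  ultimately obtain \<D> where \<D>: "\<D> \<subseteq> \<C>" "finite \<D>" "K \<subseteq> \<Union>\<D>"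
    using \<open>compact K\<close> unfolding compact_eq_openin_cover by meson
  obtain D where D: "D \<subseteq> K" "finite D" "\<D> = (\<lambda>y. {x \<in> K. w y < w x}) ` D"
    using finite_subset_image[OF \<D>(2), of _ K] \<D>(1) unfolding \<C>_def by metis
  have "D \<noteq> {}" using D \<D> \<open>K \<noteq> {}\<close> by auto
  define y where "y = arg_min_on w D"
  have y: "y \<in> D" "\<And>z. z \<in> D \<Longrightarrow> w y \<le> w z"
    using arg_min_if_finite[OF D(2) \<open>D \<noteq> {}\<close>, of w] unfolding y_def by (auto simp: not_less)
  then obtain z where "z \<in> D" "w z < w y" using D \<D>(3) by blast
  with y show False by (meson not_less)
qed

lemma openin_less_add_ennreal:
  fixes u v :: "'a \<Rightarrow> ennreal"
  assumes u: "\<And>c. openin X {x \<in> S. c < u x}" and v: "\<And>c. openin X {x \<in> S. c < v x}"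
  shows "openin X {x \<in> S. c < u x + v x}"
proof -
  \<comment> \<open>The first two alternatives cover cases such as \<open>t = 0\<close>, where no
    \<open>b < t\<close> exists. If both fail, \<open>s\<close> and \<open>t\<close> are finite and
    half of the excess \<open>s + t - c\<close> can be taken off each.\<close>
  have split: "c < s \<or> c < t \<or> (\<exists>a b. a < s \<and> b < t \<and> c \<le> a + b)" if "c < s + t" for s t :: ennreal
  proof (rule ccontr)
    assume neg: "\<not> ?thesis"
    then have le: "s \<le> c" "t \<le> c" by auto
    have "c < top" using that by (metis order_less_le_trans top_greatest)
    then have fin: "s < top" "t < top" using le by auto
    obtain s' where s': "0 \<le> s'" "s = ennreal s'" using fin(1) by (metis ennreal_cases less_irrefl)
    obtain t' where t': "0 \<le> t'" "t = ennreal t'" using fin(2) by (metis ennreal_cases less_irrefl)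
    obtain c' where c': "0 \<le> c'" "c = ennreal c'" using \<open>c < top\<close> by (metis ennreal_cases less_irrefl)
    have r: "s' \<le> c'" "t' \<le> c'" "c' < s' + t'" using le that s' t' c' by (auto simp flip: ennreal_plus simp: ennreal_less_iff)
    define e where "e = (s' + t' - c') / 2"
    have e: "0 < e" "e < s'" "e < t'" "c' \<le> (s' - e) + (t' - e)" using r unfolding e_def by (auto simp: field_simps)
    have "ennreal (s' - e) < s" "ennreal (t' - e) < t" "c \<le> ennreal (s' - e) + ennreal (t' - e)"
      using e s' t' c' by (auto simp: ennreal_less_iff simp flip: ennreal_plus intro!: ennreal_leI)
    then show False using neg by blast
  qed
  have "{x \<in> S. c < u x + v x} = {x \<in> S. c < u x} \<union> {x \<in> S. c < v x} \<union>
      \<Union> {{x \<in> S. a < u x} \<inter> {x \<in> S. b < v x} | a b. c \<le> a + b}" (is "?L = ?R")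
  proof
    show "?L \<subseteq> ?R"
    proof
      fix x assume "x \<in> ?L"
      then have "x \<in> S" "c < u x \<or> c < v x \<or> (\<exists>a b. a < u x \<and> b < v x \<and> c \<le> a + b)"
        using split[of "u x" "v x"] by auto
      then show "x \<in> ?R" by blast
    qed
    have "c < u x + v x" if "c < u x" for x using that by (rule order_less_le_trans) simp
    moreover have "c < u x + v x" if "c < v x" for x using that by (rule order_less_le_trans) simp
    moreover have "c < u x + v x" if "c \<le> a + b" "a < u x" "b < v x" for x a b
      using that by (meson add_strict_mono order_le_less_trans)
    ultimately show "?R \<subseteq> ?L" by auto
  qed
  then show ?thesis using u v by (auto intro!: openin_Un openin_Union openin_Int)
qed

lemma continuous_nn_integral_ge:
  fixes k :: "real \<Rightarrow> real"
  assumes "continuous_on {a..b} k"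
  shows "ennreal (integral {a..b} k) \<le> (\<integral>\<^sup>+ t\<in>{a..b}. ennreal (k t) \<partial>lborel)"
proof -
  have c: "continuous_on {a..b} (\<lambda>t. max 0 (k t))" by (intro continuous_intros assms)
  have "integral {a..b} k \<le> integral {a..b} (\<lambda>t. max 0 (k t))"
    by (intro integral_le integrable_continuous_real assms c) auto
  moreover have "(\<integral>\<^sup>+ t\<in>{a..b}. ennreal (max 0 (k t)) \<partial>lborel) = ennreal (integral {a..b} (\<lambda>t. max 0 (k t)))"
    by (intro nn_integral_has_integral_lebesgue' integrable_integral integrable_continuous_real c) simp
  moreover have "ennreal (max 0 r) = ennreal r" for r by (simp add: max_def ennreal_neg)
  ultimately show ?thesis by (metis (no_types, lifting) ennreal_leI nn_integral_cong)
qed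

text \<open>
  Circles are parametrised by a complex radius \<open>b\<close>, which makes the notion obviously invariant
  under affine maps.
\<close>
definition superharmonic_on :: "complex set \<Rightarrow> (complex \<Rightarrow> ennreal) \<Rightarrow> bool" where
  "superharmonic_on S v \<longleftrightarrow> (\<forall>c. open {x \<in> S. c < v x}) \<and>
     (\<forall>x b. (\<forall>\<zeta>\<in>cball 0 1. x + \<zeta> * b \<in> S) \<longrightarrow>
        (\<integral>\<^sup>+ t\<in>{0..2*pi}. v (x + cis t * b) \<partial>lborel) \<le> ennreal (2*pi) * v x)"

text \<open>A minimum principle for \<open>v - g\<close>. At a point where \<open>v - g\<close> has
  a negative minimum, \<open>step\<close> supplies a circle on which the mean of \<open>g\<close> is
  strictly larger than its value at the centre, against the mean value inequality for
  \<open>v\<close>. The first alternative in \<open>step\<close> takes the place of a boundary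
  condition.\<close>

lemma superharmonic_minorant:
  assumes v: "superharmonic_on S v" and K: "compact K" "K \<subseteq> S" and g: "continuous_on K g"
    and step: "\<And>x. x \<in> K \<Longrightarrow> ennreal (g x) \<le> v x \<or>
      (\<exists>r>0. cball x r \<subseteq> K \<and> 2*pi * g x < integral {0..2*pi} (\<lambda>t. g (x + of_real r * cis t)))"
    and "x0 \<in> K"
  shows "ennreal (g x0) \<le> v x0"
proof (rule ccontr)
  assume "\<not> ?thesis"
  then have x0: "v x0 < ennreal (g x0)" by simp
  then have gx0: "g x0 > 0" by (metis ennreal_neg not_less not_less_zero)
  obtain M where M: "\<And>x. x \<in> K \<Longrightarrow> g x \<le> M"
    using compact_continuous_image[OF g K(1)] compact_imp_bounded bounded_imp_bdd_above
    by (metis bdd_above.unfold imageI)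
  \<comment> \<open>This is \<open>v - g\<close> shifted by an upper bound \<open>M\<close> of
    \<open>g\<close>, which makes it a sum of nonnegative terms in \<open>ennreal\<close>.\<close>
  define w where "w x = v x + ennreal (M - g x)" for x
  have lsc: "openin (top_of_set K) {x \<in> K. c < w x}" for c
    unfolding w_def
  proof (rule openin_less_add_ennreal)
    fix c
    have "{x \<in> K. c < v x} = K \<inter> {x \<in> S. c < v x}" using K by auto
    then show "openin (top_of_set K) {x \<in> K. c < v x}"
      using v by (simp add: superharmonic_on_def openin_open_Int)
    have "continuous_on K (\<lambda>x. ennreal (M - g x))" by (intro continuous_on_ennreal continuous_intros g)
    then have "openin (top_of_set K) (K \<inter> (\<lambda>x. ennreal (M - g x)) -` {c<..})"
      by (rule continuous_openin_preimage_gen) auto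
    then show "openin (top_of_set K) {x \<in> K. c < ennreal (M - g x)}"
      by (simp add: vimage_def Int_def)
  qed
  obtain x where x: "x \<in> K" "\<And>y. y \<in> K \<Longrightarrow> w x \<le> w y"
    using compact_lsc_attains_inf[OF K(1) _ lsc] \<open>x0 \<in> K\<close> by blast
  obtain a0 where a0: "0 \<le> a0" "v x0 = ennreal a0" using x0 by (metis ennreal_cases not_less top_greatest)
  have "w x0 < ennreal M"
    using x0 M[OF \<open>x0 \<in> K\<close>] a0 gx0 by (auto simp: w_def ennreal_less_iff simp flip: ennreal_plus)
  then have "w x < ennreal M" using x(2)[OF \<open>x0 \<in> K\<close>] by order
  then have "v x < top" by (cases "v x") (auto simp: w_def)
  then obtain a where a: "0 \<le> a" "v x = ennreal a" by (metis ennreal_cases less_irrefl)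
  \<comment> \<open>The largest amount by which \<open>g\<close> exceeds \<open>v\<close>: on
    \<open>K\<close> the function \<open>g - \<delta>\<close> stays below \<open>v\<close>, with
    equality at the minimum point \<open>x\<close>.\<close>
  define \<delta> where "\<delta> = g x - a"
  have \<delta>: "\<delta> > 0"
    using \<open>w x < ennreal M\<close> a M[OF x(1)] by (auto simp: w_def \<delta>_def ennreal_less_iff simp flip: ennreal_plus)
  have lb: "ennreal (g y - \<delta>) \<le> v y" if y: "y \<in> K" for y
  proof (cases "v y")
    case (real b)
    then have "a + (M - g x) \<le> b + (M - g y)"
      using x(2)[OF y] M[OF y] M[OF x(1)] a by (simp add: w_def flip: ennreal_plus)
    then show ?thesis using real by (simp add: \<delta>_def ennreal_leI)
  qed simp
  have "\<not> ennreal (g x) \<le> v x" using a \<delta> by (auto simp: \<delta>_def)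
  with step[OF x(1)] obtain r where r: "r > 0" "cball x r \<subseteq> K"
     "2*pi * g x < integral {0..2*pi} (\<lambda>t. g (x + of_real r * cis t))" by blast
  have inK: "x + of_real r * cis t \<in> K" for t using r by (intro subsetD[OF r(2)]) (simp add: dist_norm norm_mult)
  have cont: "continuous_on {0..2*pi} (\<lambda>t. g (x + of_real r * cis t))"
    by (intro continuous_on_compose2[OF g] continuous_intros) (use inK in auto)
  have "ennreal (integral {0..2*pi} (\<lambda>t. g (x + of_real r * cis t) - \<delta>)) \<le>
     (\<integral>\<^sup>+ t\<in>{0..2*pi}. ennreal (g (x + of_real r * cis t) - \<delta>) \<partial>lborel)"
    by (intro continuous_nn_integral_ge continuous_intros cont)
  also have "\<dots> \<le> (\<integral>\<^sup>+ t\<in>{0..2*pi}. v (x + cis t * of_real r) \<partial>lborel)"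
    using lb[OF inK] by (intro nn_integral_mono mult_right_mono) (auto simp: mult.commute)
  also have "\<dots> \<le> ennreal (2*pi) * v x"
  proof -
    have "\<forall>\<zeta>\<in>cball 0 1. x + \<zeta> * of_real r \<in> S"
    proof
      fix \<zeta> :: complex assume "\<zeta> \<in> cball 0 1"
      then have "x + \<zeta> * of_real r \<in> cball x r" using r(1) by (simp add: dist_norm norm_mult)
      then show "x + \<zeta> * of_real r \<in> S" using r(2) K(2) by blast
    qed
    then show ?thesis using v unfolding superharmonic_on_def by blast
  qed
  finally have "ennreal (integral {0..2*pi} (\<lambda>t. g (x + of_real r * cis t) - \<delta>)) \<le> ennreal (2*pi*a)"
    using a by (simp add: ennreal_mult)
  then have "integral {0..2*pi} (\<lambda>t. g (x + of_real r * cis t) - \<delta>) \<le> 2*pi*a"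
    using a(1) by (subst (asm) ennreal_le_iff) auto
  moreover have "integral {0..2*pi} (\<lambda>t. g (x + of_real r * cis t) - \<delta>) = integral {0..2*pi} (\<lambda>t. g (x + of_real r * cis t)) - 2*pi*\<delta>"
    by (subst integral_diff) (auto intro!: integrable_continuous_real cont)
  ultimately show False using r(3) by (simp add: \<delta>_def algebra_simps)
qed

section \<open>Potentials of point charges and the hitting estimate\<close>

lemma integral_norm_sq_circle:
  fixes x :: complex
  shows "integral {0..2*pi} (\<lambda>t. (cmod (x + of_real r * cis t))\<^sup>2) = 2*pi * ((cmod x)\<^sup>2 + r\<^sup>2)"
proof -
  have "(cmod (x + of_real r * cis t))\<^sup>2 = ((cmod x)\<^sup>2 + r\<^sup>2) + 2*r*Re x * cos t + 2*r*Im x * sin t" for t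
  proof -
    have "(cmod (x + of_real r * cis t))\<^sup>2 = (Re x + r * cos t)\<^sup>2 + (Im x + r * sin t)\<^sup>2"
      by (simp add: cmod_power2)
    also have "\<dots> = ((Re x)\<^sup>2 + (Im x)\<^sup>2) + r\<^sup>2 * ((cos t)\<^sup>2 + (sin t)\<^sup>2) + 2*r*Re x * cos t + 2*r*Im x * sin t"
      unfolding power2_eq_square by (simp only: algebra_simps)
    finally show ?thesis by (simp add: cmod_power2)
  qed
  moreover have "((\<lambda>t. ((cmod x)\<^sup>2 + r\<^sup>2) + 2*r*Re x * cos t + 2*r*Im x * sin t) has_integral
      (((cmod x)\<^sup>2 + r\<^sup>2) * (2*pi) + 2*r*Re x * sin (2*pi) - 2*r*Im x * cos (2*pi)) -
      (((cmod x)\<^sup>2 + r\<^sup>2) * 0 + 2*r*Re x * sin 0 - 2*r*Im x * cos 0)) {0..2*pi}"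
    by (rule fundamental_theorem_of_calculus)
      (auto intro!: derivative_eq_intros simp flip: has_real_derivative_iff_has_vector_derivative)
  ultimately show ?thesis by (simp add: integral_unique)
qed

text \<open>The choice of \<open>t\<close> for a given \<open>s\<close> need not be continuous. If
  no radius serves for all \<open>s\<close>, parameters with failing radii \<open>1/(n+1)\<close>
  accumulate at some \<open>l\<close>; since \<open>W\<close> is 1-Lipschitz in \<open>s\<close>,
  the \<open>t\<close> chosen for \<open>l\<close> also serves for parameters near
  \<open>l\<close>.\<close>

lemma compact_family_uniform_cball:
  fixes W :: "real \<Rightarrow> real \<Rightarrow> 'a::metric_space"
  assumes "open E"
    and lip: "\<And>s s' t. \<lbrakk>s \<in> {a..b}; s' \<in> {a..b}; t \<in> T\<rbrakk> \<Longrightarrow> dist (W s t) (W s' t) \<le> \<bar>s - s'\<bar>"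
    and ex: "\<And>s. s \<in> {a..b} \<Longrightarrow> \<exists>t\<in>T. W s t \<in> E"
  obtains \<rho> where "\<rho> > 0" "\<And>s. s \<in> {a..b} \<Longrightarrow> \<exists>t\<in>T. cball (W s t) \<rho> \<subseteq> E"
proof (rule ccontr)
  assume "\<not> thesis"
  then have "\<exists>s\<in>{a..b}. \<forall>t\<in>T. \<not> cball (W s t) (inverse (real (Suc n))) \<subseteq> E" for n
    using that[of "inverse (real (Suc n))"] by fastforce
  then obtain s where s: "\<And>n. s n \<in> {a..b}" "\<And>n t. t \<in> T \<Longrightarrow> \<not> cball (W (s n) t) (inverse (real (Suc n))) \<subseteq> E"
    by metis
  obtain l \<phi> where l: "l \<in> {a..b}" "strict_mono \<phi>" "(s \<circ> \<phi>) \<longlonglongrightarrow> l"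
    using compact_Icc[of a b] s(1) unfolding compact_def by blast
  obtain t e where t: "t \<in> T" "e > 0" "ball (W l t) e \<subseteq> E"
    using ex[OF l(1)] \<open>open E\<close> by (meson open_contains_ball)
  have "\<forall>\<^sub>F n in sequentially. dist ((s \<circ> \<phi>) n) l < e/2"
    using l(3) t(2) by (intro tendstoD) (simp_all del: o_apply)
  moreover have "\<forall>\<^sub>F n in sequentially. inverse (real (Suc (\<phi> n))) < e/2"
  proof -
    have "(\<lambda>n. inverse (real (Suc (\<phi> n)))) \<longlonglongrightarrow> 0"
      using LIMSEQ_subseq_LIMSEQ[OF LIMSEQ_inverse_real_of_nat l(2)] by (simp add: o_def)
    then show ?thesis using t(2) by (intro order_tendstoD) auto
  qed
  ultimately have "\<forall>\<^sub>F n in sequentially. False"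
  proof eventually_elim
    case (elim n)
    have "cball (W (s (\<phi> n)) t) (inverse (real (Suc (\<phi> n)))) \<subseteq> ball (W l t) e"
    proof
      fix y assume "y \<in> cball (W (s (\<phi> n)) t) (inverse (real (Suc (\<phi> n))))"
      moreover have "dist (W l t) (W (s (\<phi> n)) t) \<le> \<bar>l - s (\<phi> n)\<bar>" using lip l(1) s(1) t(1) by blast
      ultimately show "y \<in> ball (W l t) e"
        using elim dist_triangle[of "W l t" y "W (s (\<phi> n)) t"] by (auto simp: dist_real_def abs_minus_commute)
    qed
    then show False using s(2)[OF t(1)] t(3) by blast
  qed
  then show False by simp
qed

text \<open>
  The comparison function \<open>g\<close> is a multiple of the potential of point charges, one at a bad point
  of the curve \<open>t \<mapsto> W s t\<close> for each \<open>s\<close> in a fine grid, for the kernel \<open>1 / sqrt |z|\<close>.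
  This kernel is subharmonic off the charges, and its integrability in one dimension keeps the
  potential bounded at distance at least \<open>\<rho>\<close> from them. The quadratic term makes the mean
  value inequality strict.
\<close>
lemma superharmonic_hitting:
  fixes W :: "real \<Rightarrow> real \<Rightarrow> complex" and \<sigma> :: "complex \<Rightarrow> real"
  assumes v: "superharmonic_on (ball 0 20) v"
    and T: "T \<subseteq> {0<..1}"
    and lip: "\<And>s s' t. \<lbrakk>s \<in> {\<alpha>..\<alpha>+1}; s' \<in> {\<alpha>..\<alpha>+1}; t \<in> T\<rbrakk> \<Longrightarrow> cmod (W s t - W s' t) \<le> \<bar>s - s'\<bar>"
    and far: "\<And>s t z. \<lbrakk>s \<in> {\<alpha>..\<alpha>+1}; t \<in> T\<rbrakk> \<Longrightarrow> t * \<bar>s - \<sigma> z\<bar> \<le> 8 * cmod (z - W s t)"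
    and near: "\<And>s t. \<lbrakk>s \<in> {\<alpha>..\<alpha>+1}; t \<in> T\<rbrakk> \<Longrightarrow> cmod (W s t) \<le> 4*t \<and> cmod (W s t) \<le> 3"
    and bad: "\<And>s. s \<in> {\<alpha>..\<alpha>+1} \<Longrightarrow> \<exists>t\<in>T. 1 \<le> v (W s t)"
  shows "ennreal (1/200) \<le> v 0"
proof -
  \<comment> \<open>Lower semicontinuity makes \<open>E\<close> open. The bad points, where
    \<open>v \<ge> 1\<close>, lie in it, so discs about them fit into it.\<close>
  define E where "E = {x \<in> ball 0 20. ennreal (1/2) < v x}"
  have "open E" using v by (auto simp: superharmonic_on_def E_def)
  have half1: "ennreal (1/2) < 1" using ennreal_less_iff[of "1/2" 1] by simp
  obtain \<rho> where \<rho>: "\<rho> > 0" "\<And>s. s \<in> {\<alpha>..\<alpha>+1} \<Longrightarrow> \<exists>t\<in>T. cball (W s t) \<rho> \<subseteq> E"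
  proof (rule compact_family_uniform_cball[OF \<open>open E\<close>, of \<alpha> "\<alpha>+1" T W])
    show "dist (W s t) (W s' t) \<le> \<bar>s - s'\<bar>" if "s \<in> {\<alpha>..\<alpha>+1}" "s' \<in> {\<alpha>..\<alpha>+1}" "t \<in> T" for s s' t
      using lip[OF that] by (simp add: dist_norm)
    show "\<exists>t\<in>T. W s t \<in> E" if s: "s \<in> {\<alpha>..\<alpha>+1}" for s
    proof -
      obtain t where t: "t \<in> T" "1 \<le> v (W s t)" using bad[OF s] by blast
      have "W s t \<in> E" using t near[OF s t(1)] half1 by (auto simp: E_def)
      then show ?thesis using t by blast
    qed
  qed blast
  \<comment> \<open>The grid spacing \<open>1/N\<close> is at most \<open>\<rho>\<close>, so off the
    discs every charge is at least one spacing away. This produces the 1 in \<open>max 1\<close> in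
    the estimate of \<open>p\<close> below.\<close>
  obtain N :: nat where N: "N > 0" "1 / real N \<le> \<rho>"
    using real_arch_inverse[of \<rho>] \<rho>(1) by (auto simp: inverse_eq_divide less_imp_le)
  define s where "s j = \<alpha> + real j / real N" for j
  have sI: "s j \<in> {\<alpha>..\<alpha>+1}" if "j < N" for j using that by (auto simp: s_def)
  have "\<forall>j. \<exists>t. j < N \<longrightarrow> t \<in> T \<and> cball (W (s j) t) \<rho> \<subseteq> E" using \<rho>(2) sI by blast
  then obtain t where t: "\<And>j. j < N \<Longrightarrow> t j \<in> T" "\<And>j. j < N \<Longrightarrow> cball (W (s j) (t j)) \<rho> \<subseteq> E"
    by metis
  define w where "w j = W (s j) (t j)" for j
  have t01: "0 < t j" "t j \<le> 1" if "j < N" for j using t(1)[OF that] T by auto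
  have wE: "cball (w j) \<rho> \<subseteq> E" if "j < N" for j using t(2)[OF that] by (simp add: w_def)
  have w4: "cmod (w j) \<le> 4 * t j" "cmod (w j) \<le> 3" if "j < N" for j
    using near[OF sI[OF that] t(1)[OF that]] by (auto simp: w_def)
  define K where "K = cball 0 19 - (\<Union>j<N. ball (w j) \<rho>)"
  have K: "compact K" "K \<subseteq> ball 0 20" "K \<subseteq> cball 0 19"
    unfolding K_def by (auto intro!: compact_diff)
  have wK: "\<rho> \<le> cmod (z - w j)" if "z \<in> K" "j < N" for z j
    using that by (auto simp: K_def dist_norm norm_minus_commute not_less)
  have wK0: "z \<noteq> w j" if "z \<in> K" "j < N" for z j using wK[OF that] \<rho>(1) by auto
  define q where "q j z = 1 / sqrt (cmod (z - w j))" for j z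
  \<comment> \<open>The weights \<open>sqrt (t j)\<close> balance two estimates. By
    \<open>near\<close>, \<open>cmod (w j) \<le> 4 * t j\<close>, so each weighted term is at least
    1/2 at 0; in the upper bound they cancel the factor \<open>t\<close> of
    \<open>far\<close>.\<close>
  define p where "p z = (\<Sum>j<N. sqrt (t j) * q j z) / real N" for z
  \<comment> \<open>The constants give \<open>g \<le> 0\<close> on the circle of radius 19, where
    \<open>p \<le> 1/4\<close> and the quadratic term vanishes; \<open>g \<le> 1/2\<close> on
    \<open>K\<close>, where \<open>p \<le> 15\<close>; and, if 0 is in \<open>K\<close>,
    \<open>g 0 \<ge> 1/128 - 1/1000\<close>, which exceeds 1/200.\<close>
  define g where "g z = (p z - 1/4) / 32 + ((cmod z)\<^sup>2 - 361) / 361000" for z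
  have contq: "continuous_on K (q j)" if "j < N" for j
    unfolding q_def by (intro continuous_intros) (use wK0 that in auto)
  have contg: "continuous_on K g"
    unfolding g_def p_def by (intro continuous_intros contq) (use N in auto)
  \<comment> \<open>In grid units, \<open>x\<close> is the position of \<open>\<sigma> z\<close>.
    Then \<open>far\<close> and the choice of \<open>N\<close> bound the distance of
    \<open>z\<close> to the charge \<open>j\<close> from below by a multiple of
    \<open>t j * max 1 |j - x|\<close>, which leads to the one-dimensional sum.\<close>
  have p15: "p z \<le> 15" if z: "z \<in> K" for z
  proof -
    define x where "x = real N * (\<sigma> z - \<alpha>)"
    have "sqrt (t j) * q j z \<le> sqrt (8 * real N) * (1 / sqrt (max 1 \<bar>real j - x\<bar>))" if j: "j < N" for j
    proof -
      define d where "d = cmod (z - w j)"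
      have d: "d \<ge> \<rho>" "d > 0" using wK[OF z j] \<rho>(1) by (auto simp: d_def)
      have "real j - x = real N * (s j - \<sigma> z)" using N by (simp add: x_def s_def field_simps)
      then have "\<bar>real j - x\<bar> = real N * \<bar>s j - \<sigma> z\<bar>" by (simp add: abs_mult)
      then have "t j * \<bar>real j - x\<bar> = real N * (t j * \<bar>s j - \<sigma> z\<bar>)" by simp
      also have "\<dots> \<le> real N * (8 * d)"
        using far[OF sI[OF j] t(1)[OF j], of z] by (intro mult_left_mono) (auto simp: d_def w_def)
      finally have A: "t j * \<bar>real j - x\<bar> \<le> 8 * real N * d" by simp
      have "1 \<le> real N * \<rho>" using N by (simp add: field_simps)
      also have "\<dots> \<le> real N * d" using d by (intro mult_left_mono) auto
      finally have B: "t j * 1 \<le> 8 * real N * d" using t01[OF j] by simp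
      have "t j * max 1 \<bar>real j - x\<bar> \<le> 8 * real N * d" using A B by (simp add: max_def)
      then have "sqrt (t j * max 1 \<bar>real j - x\<bar>) \<le> sqrt (8 * real N * d)" by simp
      then have C: "sqrt (t j) * sqrt (max 1 \<bar>real j - x\<bar>) \<le> sqrt (8 * real N) * sqrt d" by (simp add: real_sqrt_mult)
      have "sqrt (max 1 \<bar>real j - x\<bar>) > 0" "sqrt d > 0" using d by auto
      then show ?thesis using C unfolding q_def d_def[symmetric] by (simp add: field_simps)
    qed
    then have "(\<Sum>j<N. sqrt (t j) * q j z) \<le> (\<Sum>j<N. sqrt (8 * real N) * (1 / sqrt (max 1 \<bar>real j - x\<bar>)))"
      by (intro sum_mono) auto
    also have "\<dots> \<le> sqrt (8 * real N) * (5 * sqrt (real N))"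
      unfolding sum_distrib_left[symmetric] by (intro mult_left_mono sum_inverse_sqrt_dist_le) auto
    also have "\<dots> = 5 * sqrt 8 * real N" by (simp add: real_sqrt_mult)
    also have "\<dots> \<le> 5 * 3 * real N"
      by (intro mult_left_mono mult_right_mono real_le_lsqrt) auto
    finally show ?thesis using N unfolding p_def by (simp add: field_simps)
  qed
  have p_sphere: "p z \<le> 1/4" if z: "cmod z = 19" for z
  proof -
    have "sqrt (t j) * q j z \<le> 1/4" if j: "j < N" for j
    proof -
      have "cmod (z - w j) \<ge> 16" using norm_triangle_ineq2[of z "w j"] z w4[OF j] by simp
      then have "sqrt 16 \<le> sqrt (cmod (z - w j))" by (simp only: real_sqrt_le_iff)
      then have "sqrt (cmod (z - w j)) \<ge> 4" by simp
      then have "q j z \<le> 1/4" unfolding q_def by (intro divide_left_mono) auto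
      moreover have "sqrt (t j) \<le> 1" "0 \<le> sqrt (t j)" using t01[OF j] by auto
      ultimately show ?thesis using mult_mono[of "sqrt (t j)" 1 "q j z" "1/4"] by (simp add: q_def)
    qed
    then have "(\<Sum>j<N. sqrt (t j) * q j z) \<le> real N * (1/4)"
      using sum_bounded_above[of "{..<N}" "\<lambda>j. sqrt (t j) * q j z" "1/4"] by auto
    then show ?thesis using N unfolding p_def by (simp add: field_simps)
  qed
  have p0: "p 0 \<ge> 1/2" if "0 \<in> K"
  proof -
    have "sqrt (t j) * q j 0 \<ge> 1/2" if j: "j < N" for j
    proof -
      have pos: "cmod (w j) > 0" using wK[OF \<open>0 \<in> K\<close> j] \<rho>(1) by auto
      have "sqrt (cmod (w j)) \<le> sqrt (4 * t j)" using w4[OF j] by simp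
      then have "sqrt (cmod (w j)) \<le> 2 * sqrt (t j)" by (simp add: real_sqrt_mult)
      then show ?thesis using pos by (simp add: q_def field_simps)
    qed
    then have "(\<Sum>j<N. sqrt (t j) * q j 0) \<ge> real N * (1/2)"
      using sum_bounded_below[of "{..<N}" "1/2" "\<lambda>j. sqrt (t j) * q j 0"] by auto
    then show ?thesis using N unfolding p_def by (simp add: field_simps)
  qed
  have step: "ennreal (g x) \<le> v x \<or>
      (\<exists>r>0. cball x r \<subseteq> K \<and> 2*pi * g x < integral {0..2*pi} (\<lambda>t. g (x + of_real r * cis t)))"
    if x: "x \<in> K" for x
  proof (cases "cmod x = 19 \<or> x \<in> E")
    case True
    then show ?thesis
    proof
      assume "cmod x = 19"
      then have "g x \<le> 0" using p_sphere[of x] by (simp add: g_def)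
      then show ?thesis by (simp add: ennreal_neg)
    next
      assume E: "x \<in> E"
      have "(cmod x)\<^sup>2 \<le> 19\<^sup>2" using x K(3) by (intro power_mono) auto
      then have "g x \<le> (15 - 1/4) / 32 + (361 - 361) / 361000"
        unfolding g_def by (intro add_mono divide_right_mono diff_right_mono p15[OF x]) auto
      then have "g x \<le> 1/2" by simp
      then have "ennreal (g x) \<le> ennreal (1/2)" by (rule ennreal_leI)
      also have "\<dots> < v x" using E by (simp add: E_def)
      finally show ?thesis by (simp add: less_imp_le)
    qed
  next
    case False
    \<comment> \<open>The closed discs about the charges lie in \<open>E\<close>, so a point of
      \<open>K\<close> outside \<open>E\<close> and off the circle of radius 19 is interior to
      \<open>K\<close>, and a small disc about it fits.\<close>
    define V where "V = ball 0 19 - (\<Union>j<N. cball (w j) \<rho>)"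
    have "open V" unfolding V_def by (intro open_Diff closed_UN) auto
    moreover have "x \<in> V" using False x wE K(3) unfolding V_def by force
    ultimately obtain r where r: "r > 0" "cball x r \<subseteq> V" by (meson open_contains_cball)
    have "V \<subseteq> K" unfolding V_def K_def using ball_subset_cball by fastforce
    then have rK: "cball x r \<subseteq> K" using r by blast
    have inK: "x + of_real r * cis \<theta> \<in> K" for \<theta>
      using r(1) by (intro subsetD[OF rK]) (simp add: dist_norm norm_mult)
    have cq: "(\<lambda>\<theta>. q j (x + of_real r * cis \<theta>)) integrable_on {0..2*pi}" if "j < N" for j
      by (intro integrable_continuous_real continuous_on_compose2[OF contq[OF that]] continuous_intros) (use inK in auto)
    have cn: "(\<lambda>\<theta>. (cmod (x + of_real r * cis \<theta>))\<^sup>2) integrable_on {0..2*pi}"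
      by (intro integrable_continuous_real continuous_intros)
    have "2*pi * q j x \<le> integral {0..2*pi} (\<lambda>\<theta>. q j (x + of_real r * cis \<theta>))" if j: "j < N" for j
      unfolding q_def using r(1) wK0[OF _ j] rK by (intro inverse_sqrt_kernel_submean) blast+
    then have "(\<Sum>j<N. sqrt (t j) * (2*pi * q j x)) \<le> (\<Sum>j<N. sqrt (t j) * integral {0..2*pi} (\<lambda>\<theta>. q j (x + of_real r * cis \<theta>)))"
      using t01 by (intro sum_mono mult_left_mono) (auto intro: less_imp_le)
    moreover have "2*pi * p x = (\<Sum>j<N. sqrt (t j) * (2*pi * q j x)) / real N"
      by (simp add: p_def sum_distrib_left mult_ac)
    moreover have hp: "((\<lambda>\<theta>. p (x + of_real r * cis \<theta>)) has_integral
        (\<Sum>j<N. sqrt (t j) * integral {0..2*pi} (\<lambda>\<theta>. q j (x + of_real r * cis \<theta>))) / real N) {0..2*pi}"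
      unfolding p_def using cq
      by (intro has_integral_divide has_integral_sum has_integral_mult_right integrable_integral) auto
    ultimately have pp: "2*pi * p x \<le> integral {0..2*pi} (\<lambda>\<theta>. p (x + of_real r * cis \<theta>))"
      using N by (simp add: integral_unique[OF hp] divide_right_mono)
    have "((\<lambda>\<theta>. g (x + of_real r * cis \<theta>)) has_integral
       (integral {0..2*pi} (\<lambda>\<theta>. p (x + of_real r * cis \<theta>)) - (2*pi - 0) *\<^sub>R (1/4)) / 32 +
       (2*pi * ((cmod x)\<^sup>2 + r\<^sup>2) - (2*pi - 0) *\<^sub>R 361) / 361000) {0..2*pi}"
      unfolding g_def
      using hp cn integral_norm_sq_circle[of x r]
      by (intro has_integral_add has_integral_divide has_integral_diff has_integral_const_real)
        (auto simp: integral_unique intro!: integrable_integral  has_integral_integrable_integral[THEN iffD2])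
    moreover have "2*pi * g x < (integral {0..2*pi} (\<lambda>\<theta>. p (x + of_real r * cis \<theta>)) - (2*pi - 0) *\<^sub>R (1/4)) / 32 +
       (2*pi * ((cmod x)\<^sup>2 + r\<^sup>2) - (2*pi - 0) *\<^sub>R 361) / 361000"
    proof -
      have "2*pi * g x = (2*pi * p x - 2*pi*(1/4)) / 32 + (2*pi * (cmod x)\<^sup>2 - 2*pi*361) / 361000"
        by (simp add: g_def algebra_simps add_divide_distrib diff_divide_distrib)
      moreover have "0 < 2*pi * r\<^sup>2" using r(1) by simp
      ultimately show ?thesis using pp by (simp add: algebra_simps add_divide_distrib diff_divide_distrib)
    qed
    ultimately show ?thesis using rK r(1) by (auto simp: integral_unique)
  qed
  show ?thesis
  proof (cases "0 \<in> K")
    case True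
    have "1/200 \<le> (1/2 - 1/4) / 32 + ((cmod 0)\<^sup>2 - 361) / (361000::real)" by simp
    also have "\<dots> \<le> g 0"
      unfolding g_def by (intro add_mono divide_right_mono diff_right_mono p0[OF True]) auto
    finally have "ennreal (1/200) \<le> ennreal (g 0)" by (rule ennreal_leI)
    also have "\<dots> \<le> v 0" by (rule superharmonic_minorant[OF v K(1,2) contg step True])
    finally show ?thesis .
  next
    case False
    \<comment> \<open>Here 0 lies in one of the removed discs, all of which are contained in
      \<open>E\<close>.\<close>
    then obtain j where "j < N" "0 \<in> ball (w j) \<rho>" by (auto simp: K_def)
    then have "0 \<in> E" using wE ball_subset_cball by blast
    then have "ennreal (1/2) < v 0" by (simp add: E_def)
    moreover have "ennreal (1/200) \<le> ennreal (1/2)" by (intro ennreal_leI) simp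
    ultimately show ?thesis by order
  qed
qed

section \<open>Rays, segments and fine connectedness in the plane\<close>

lemma superharmonic_on_subset:
  assumes "superharmonic_on S v" "open S'" "S' \<subseteq> S"
  shows "superharmonic_on S' v"
proof -
  have "{x \<in> S'. c < v x} = S' \<inter> {x \<in> S. c < v x}" for c using assms(3) by auto
  then show ?thesis using assms unfolding superharmonic_on_def by (auto simp: subset_iff)
qed

lemma superharmonic_on_affine:
  assumes "superharmonic_on S v"
  shows "superharmonic_on {\<zeta>. a + \<zeta> * e \<in> S} (\<lambda>\<zeta>. v (a + \<zeta> * e))"
  unfolding superharmonic_on_def
proof (intro conjI allI impI)
  fix c
  have "open ((\<lambda>\<zeta>. a + \<zeta> * e) -` {x \<in> S. c < v x})"
    using assms by (intro open_vimage continuous_intros) (auto simp: superharmonic_on_def)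
  then show "open {\<zeta> \<in> {\<zeta>. a + \<zeta> * e \<in> S}. c < v (a + \<zeta> * e)}" by (simp add: vimage_def)
next
  fix x b assume *: "\<forall>\<zeta>\<in>cball 0 1. x + \<zeta> * b \<in> {\<zeta>. a + \<zeta> * e \<in> S}"
  have eq: "a + (x + \<zeta> * b) * e = (a + x * e) + \<zeta> * (b * e)" for \<zeta> by (simp add: algebra_simps)
  have "\<forall>\<zeta>\<in>cball 0 1. (a + x * e) + \<zeta> * (b * e) \<in> S" using * by (simp add: eq)
  then show "(\<integral>\<^sup>+ t\<in>{0..2*pi}. v (a + (x + cis t * b) * e) \<partial>lborel) \<le> ennreal (2*pi) * v (a + x * e)"
    unfolding eq using assms unfolding superharmonic_on_def by blast
qed

lemma superharmonic_on_ball_rescale: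
  assumes "superharmonic_on (ball x r) v" "0 < r" "k * cmod e \<le> r"
  shows "superharmonic_on (ball 0 k) (\<lambda>\<zeta>. v (x + \<zeta> * e))"
proof (rule superharmonic_on_subset[OF superharmonic_on_affine[OF assms(1)]])
  show "ball 0 k \<subseteq> {\<zeta>. x + \<zeta> * e \<in> ball x r}"
  proof clarify
    fix \<zeta> :: complex assume "\<zeta> \<in> ball 0 k"
    then have "cmod \<zeta> * cmod e < r"
    proof (cases "e = 0")
      case False
      then have "cmod \<zeta> * cmod e < k * cmod e" using \<open>\<zeta> \<in> ball 0 k\<close> by simp
      then show ?thesis using assms(3) by simp
    qed (use assms in simp)
    then show "x + \<zeta> * e \<in> ball x r" by (simp add: dist_norm norm_mult)
  qed
qed auto

text \<open>Otherwise, in the frame in which \<open>e\<close> is the unit vector 1, each ray with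
  slope in \<open>{\<alpha>..\<alpha>+1}\<close> contains a bad point, and
  \<open>superharmonic_hitting\<close> forces \<open>v x \<ge> 1/200\<close>.\<close>

lemma superharmonic_good_ray:
  assumes v: "superharmonic_on (ball x r) v" "0 < r" "20 * cmod e \<le> r" "v x < ennreal (1/200)"
    and \<alpha>: "-2 \<le> \<alpha>" "\<alpha> \<le> 1"
  obtains s where "s \<in> {\<alpha>..\<alpha>+1}" "\<And>t. t \<in> {0..1} \<Longrightarrow> v (x + of_real t * Complex 1 s * e) < 1"
proof (rule ccontr)
  assume "\<not> thesis"
  then have bad: "\<exists>t\<in>{0..1}. 1 \<le> v (x + of_real t * Complex 1 s * e)" if "s \<in> {\<alpha>..\<alpha>+1}" for s
    using \<open>\<And>s. \<lbrakk>s \<in> {\<alpha>..\<alpha>+1}; \<And>t. t \<in> {0..1} \<Longrightarrow> v (x + of_real t * Complex 1 s * e) < 1\<rbrakk> \<Longrightarrow> thesis\<close> that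
    by (meson not_less)
  \<comment> \<open>The slope of \<open>z\<close> as seen from 0, clamped to \<open>{-2..2}\<close>,
    which contains all slopes \<open>s\<close>, and set to 0 outside the right half-plane.\<close>
  define \<sigma> where "\<sigma> z = (if Re z > 0 then max (-2) (min 2 (Im z / Re z)) else 0)" for z
  have small: "ennreal (1/200) \<le> 1" using ennreal_leI[of "1/200" 1] by simp
  have "ennreal (1/200) \<le> v (x + 0 * e)"
  proof (rule superharmonic_hitting[OF superharmonic_on_ball_rescale[OF v(1-3)], of "{0<..1}" \<alpha> "\<lambda>s t. of_real t * Complex 1 s" \<sigma>])
    fix s t :: real and z :: complex assume s: "s \<in> {\<alpha>..\<alpha>+1}" and t: "t \<in> {0<..1}"
    have s2: "\<bar>s\<bar> \<le> 2" using s \<alpha> by auto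
    define D where "D = cmod (z - of_real t * Complex 1 s)"
    have D: "\<bar>Re z - t\<bar> \<le> D" "\<bar>Im z - t * s\<bar> \<le> D"
      using abs_Re_le_cmod[of "z - of_real t * Complex 1 s"] abs_Im_le_cmod[of "z - of_real t * Complex 1 s"]
      by (simp_all add: D_def)
    show "t * \<bar>s - \<sigma> z\<bar> \<le> 8 * cmod (z - of_real t * Complex 1 s)"
    \<comment> \<open>Far from the point on the ray the crude bound 4 for
      \<open>|s - \<sigma> z|\<close> is enough. Close to it \<open>Re z > t/2\<close>, and slopes
      can be compared after multiplication by \<open>Re z\<close>.\<close>
    proof (cases "t / 2 \<le> D")
      case True
      have "\<bar>\<sigma> z\<bar> \<le> 2" by (auto simp: \<sigma>_def)
      then have "t * \<bar>s - \<sigma> z\<bar> \<le> t * 4" using s2 t by (intro mult_left_mono) auto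
      then show ?thesis using True by (simp flip: D_def)
    next
      case False
      then have R: "t / 2 < Re z" using D(1) by simp
      then have pos: "0 < Re z" using t by simp
      define u where "u = Im z / Re z"
      have "\<bar>s - \<sigma> z\<bar> \<le> \<bar>s - u\<bar>" using pos s2 by (auto simp: \<sigma>_def u_def)
      then have "t * \<bar>s - \<sigma> z\<bar> \<le> t * \<bar>s - u\<bar>" using t by (intro mult_left_mono) auto
      also have "\<dots> \<le> 2 * (Re z * \<bar>s - u\<bar>)" using mult_right_mono[of "t" "2 * Re z" "\<bar>s - u\<bar>"] R by simp
      also have "Re z * \<bar>s - u\<bar> = \<bar>Re z * (s - u)\<bar>" using pos by (simp add: abs_mult)
      also have "Re z * (s - u) = s * (Re z - t) - (Im z - t * s)" using pos by (simp add: u_def algebra_simps)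
      also have "\<bar>s * (Re z - t) - (Im z - t * s)\<bar> \<le> \<bar>s\<bar> * \<bar>Re z - t\<bar> + \<bar>Im z - t * s\<bar>"
        by (metis abs_mult abs_triangle_ineq4)
      also have "\<dots> \<le> 2 * D + D" using s2 D by (intro add_mono mult_mono) auto
      finally show ?thesis using D by (simp flip: D_def)
    qed
  next
    fix s s' t :: real assume "t \<in> {0<..1}"
    have "of_real t * Complex 1 s - of_real t * Complex 1 s' = of_real (t * (s - s')) * \<i>"
      by (simp add: complex_eq_iff algebra_simps)
    then have "cmod (of_real t * Complex 1 s - of_real t * Complex 1 s') = t * \<bar>s - s'\<bar>"
      using \<open>t \<in> {0<..1}\<close> by (simp only: norm_mult norm_of_real) (simp add: abs_mult)
    also have "\<dots> \<le> \<bar>s - s'\<bar>" using \<open>t \<in> {0<..1}\<close> mult_right_mono[of t 1 "\<bar>s - s'\<bar>"] by simp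
    finally show "cmod (of_real t * Complex 1 s - of_real t * Complex 1 s') \<le> \<bar>s - s'\<bar>" .
  next
    fix s t :: real assume s: "s \<in> {\<alpha>..\<alpha>+1}" and t: "t \<in> {0<..1}"
    have "cmod (Complex 1 s) \<le> 3" using cmod_le[of "Complex 1 s"] s \<alpha> by auto
    then have "cmod (of_real t * Complex 1 s) \<le> t * 3" using t by (simp add: norm_mult)
    then show "cmod (of_real t * Complex 1 s) \<le> 4 * t \<and> cmod (of_real t * Complex 1 s) \<le> 3" using t by auto
  next
    fix s assume "s \<in> {\<alpha>..\<alpha>+1}"
    then obtain t where t: "t \<in> {0..1}" "1 \<le> v (x + of_real t * Complex 1 s * e)" using bad by blast
    have "t \<noteq> 0"
    proof
      assume "t = 0"
      then have "1 \<le> v x" using t(2) by simp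
      then show False using v(4) small by order
    qed
    then show "\<exists>t\<in>{0<..1}. 1 \<le> v (x + of_real t * Complex 1 s * e)" using t by force
  qed auto
  then show False using v(4) by simp
qed

text \<open>The hitting estimate with charges along the segment itself: \<open>t\<close> is fixed at
  1 and \<open>s\<close> runs over the segment. Since \<open>e\<close> may be arbitrarily short, it
  says that a segment is not thin at its end point \<open>x\<close>.\<close>

lemma superharmonic_segment_not_thin:
  assumes v: "superharmonic_on (ball x r) v" "0 < r" "20 * cmod e \<le> r" "v x < ennreal (1/200)"
  obtains s where "s \<in> {1..2}" "v (x + of_real s * e) < 1"
proof (rule ccontr)
  assume "\<not> thesis"
  then have bad: "1 \<le> v (x + of_real s * e)" if "s \<in> {1..2}" for s
    using \<open>\<And>s. \<lbrakk>s \<in> {1..2}; v (x + of_real s * e) < 1\<rbrakk> \<Longrightarrow> thesis\<close> that by (meson not_less)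
  have "ennreal (1/200) \<le> v (x + 0 * e)"
  proof (rule superharmonic_hitting[OF superharmonic_on_ball_rescale[OF v(1-3)], of "{1}" 1 "\<lambda>s t. of_real s" Re])
    fix s t :: real and z :: complex assume "t \<in> {1}"
    then show "t * \<bar>s - Re z\<bar> \<le> 8 * cmod (z - of_real s)"
      using abs_Re_le_cmod[of "z - of_real s"] by (simp add: abs_minus_commute)
  qed (use bad in \<open>auto simp flip: of_real_diff\<close>)
  then show False using v(4) by simp
qed

text \<open>In coordinates with \<open>x = 0\<close> and \<open>y = 1\<close> both rays run into the
  upper half-plane: the second slope is negative, but it refers to the reversed direction
  \<open>x - y\<close>. Hence the rays cross.\<close>

lemma superharmonic_good_path:
  assumes v1: "superharmonic_on (ball x r) v1" "v1 x < ennreal (1/200)"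
    and v2: "superharmonic_on (ball y r) v2" "v2 y < ennreal (1/200)"
    and r: "0 < r" "20 * dist x y \<le> r"
  obtains w where "closed_segment x w \<subseteq> {z \<in> ball x r. v1 z < 1}" "closed_segment y w \<subseteq> {z \<in> ball y r. v2 z < 1}"
proof -
  have e: "20 * cmod (y - x) \<le> r" "20 * cmod (x - y) \<le> r" using r by (simp_all add: dist_norm norm_minus_commute)
  obtain s where s: "s \<in> {1..2}" "\<And>t. t \<in> {0..1} \<Longrightarrow> v1 (x + of_real t * Complex 1 s * (y - x)) < 1"
    using superharmonic_good_ray[OF v1(1) r(1) e(1) v1(2), of 1] by auto
  obtain s' where s': "s' \<in> {-2..-1}" "\<And>t. t \<in> {0..1} \<Longrightarrow> v2 (y + of_real t * Complex 1 s' * (x - y)) < 1"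
    using superharmonic_good_ray[OF v2(1) r(1) e(2) v2(2), of "-2"] by auto
  \<comment> \<open>The solution of \<open>t0 + t1 = 1\<close> and
    \<open>t0 * s + t1 * s' = 0\<close>, the equations of the crossing point.\<close>
  define t0 t1 where "t0 = s' / (s' - s)" and "t1 = s / (s - s')"
  have t: "t0 \<in> {0..1}" "t1 \<in> {0..1}" using s(1) s'(1) by (auto simp: t0_def t1_def field_simps)
  define w where "w = x + of_real t0 * Complex 1 s * (y - x)"
  have w': "w = y + of_real t1 * Complex 1 s' * (x - y)"
  proof -
    have "of_real t0 * Complex 1 s + of_real t1 * Complex 1 s' = 1"
      using s(1) s'(1) by (simp add: complex_eq_iff t0_def t1_def divide_simps) (simp add: algebra_simps)
    then have "(of_real t0 * Complex 1 s + of_real t1 * Complex 1 s') * (y - x) = y - x" by simp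
    then show ?thesis unfolding w_def by (simp add: algebra_simps)
  qed
  have seg: "closed_segment p (p + of_real \<tau> * Complex 1 \<sigma> * d) \<subseteq> {z \<in> ball p r. v z < 1}"
    if "\<tau> \<in> {0..1}" "\<bar>\<sigma>\<bar> \<le> 2" "20 * cmod d \<le> r" "\<And>t. t \<in> {0..1} \<Longrightarrow> v (p + of_real t * Complex 1 \<sigma> * d) < 1" for p \<tau> \<sigma> d v
  proof
    fix z assume "z \<in> closed_segment p (p + of_real \<tau> * Complex 1 \<sigma> * d)"
    then obtain u where u: "0 \<le> u" "u \<le> 1" "z = (1 - u) *\<^sub>R p + u *\<^sub>R (p + of_real \<tau> * Complex 1 \<sigma> * d)"
      by (auto simp: closed_segment_def)
    then have z: "z = p + of_real (u * \<tau>) * Complex 1 \<sigma> * d"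
      by (simp add: scaleR_conv_of_real algebra_simps)
    have ut: "u * \<tau> \<in> {0..1}" using u that(1) by (auto simp: mult_le_one)
    have "cmod (Complex 1 \<sigma>) \<le> 3" using cmod_le[of "Complex 1 \<sigma>"] that(2) by simp
    then have "cmod (of_real (u * \<tau>) * Complex 1 \<sigma> * d) \<le> 1 * 3 * cmod d"
      unfolding norm_mult using ut by (intro mult_mono) (auto simp del: of_real_mult)
    also have "\<dots> < r" using that(3) r(1) by (cases "d = 0") auto
    finally show "z \<in> {z \<in> ball p r. v z < 1}" using that(4)[OF ut] by (simp add: z dist_norm)
  qed
  have "closed_segment x w \<subseteq> {z \<in> ball x r. v1 z < 1}"
    unfolding w_def using s(1) by (intro seg t e s(2)) auto
  moreover have "closed_segment y w \<subseteq> {z \<in> ball y r. v2 z < 1}"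
    unfolding w' using s'(1) by (intro seg t e s'(2)) auto
  ultimately show thesis by (rule that)
qed

section \<open>Baire's theorem and fine connectedness of segments\<close>

text \<open>Here \<open>loc\<close> abstracts the crossing argument and \<open>seg\<close> the fact
  that segments are not thin at their end points. As \<open>r\<close> may have no positive lower
  bound, Baire's theorem is used on the closed set \<open>S\<close> of points where \<open>f\<close>
  is not locally constant.\<close>

lemma locally_comparable_imp_constant:
  fixes f :: "real \<Rightarrow> bool" and r :: "real \<Rightarrow> real"
  assumes pos: "\<And>t. t \<in> {0..1} \<Longrightarrow> 0 < r t"
    and loc: "\<And>s t. \<lbrakk>s \<in> {0..1}; t \<in> {0..1}; \<bar>s - t\<bar> < r s; \<bar>s - t\<bar> < r t\<rbrakk> \<Longrightarrow> f s = f t"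
    and seg: "\<And>s t. \<lbrakk>s \<in> {0..1}; t \<in> {0..1}; s \<noteq> t\<rbrakk> \<Longrightarrow> \<exists>u\<in>open_segment s t. f u = f s"
  shows "f 0 = f 1"
proof (rule ccontr)
  assume ne: "f 0 \<noteq> f 1"
  define S where "S = {t \<in> {0..1}. \<forall>\<epsilon>>0. \<exists>u\<in>{0..1}. \<bar>u - t\<bar> < \<epsilon> \<and> f u \<noteq> f t}"
  have "S \<noteq> {}"
  proof
    assume "S = {}"
    then have *: "\<exists>\<epsilon>>0. \<forall>u\<in>{0..1}. \<bar>u - t\<bar> < \<epsilon> \<longrightarrow> f u = f t" if "t \<in> {0..1}" for t
      using that by (auto simp: S_def)
    have "\<forall>t\<in>{0..1}. eventually (\<lambda>u. f t = f u) (at t within {0..1})"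
      unfolding eventually_at dist_real_def using * by metis
    then have "f 0 = f 1"
      by (intro connected_local_const[of "{0..1::real}"]) auto
    with ne show False ..
  qed
  have "closed S"
    unfolding closed_sequential_limits
  proof clarify
    fix q l assume q: "\<forall>n. q n \<in> S" "q \<longlonglongrightarrow> l"
    have l01: "l \<in> {0..1}" using q closed_sequentially[of "{0..1::real}" q l] by (auto simp: S_def)
    have "\<exists>u\<in>{0..1}. \<bar>u - l\<bar> < \<epsilon> \<and> f u \<noteq> f l" if "\<epsilon> > 0" for \<epsilon>
    proof -
      obtain n where n: "\<bar>q n - l\<bar> < \<epsilon>/2"
        using q(2) \<open>\<epsilon> > 0\<close> by (metis LIMSEQ_iff half_gt_zero_iff order_refl real_norm_def)
      obtain u where u: "u \<in> {0..1}" "\<bar>u - q n\<bar> < \<epsilon>/2" "f u \<noteq> f (q n)"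
      proof -
        have "\<forall>\<epsilon>>0. \<exists>u\<in>{0..1}. \<bar>u - q n\<bar> < \<epsilon> \<and> f u \<noteq> f (q n)" using q(1) by (simp add: S_def)
        then show thesis using \<open>\<epsilon> > 0\<close> half_gt_zero that by blast
      qed
      have "q n \<in> {0..1}" using q(1) by (auto simp: S_def)
      moreover have "\<bar>u - l\<bar> < \<epsilon>" "\<bar>q n - l\<bar> < \<epsilon>" using n u(2) by linarith+
      ultimately show ?thesis using u by metis
    qed
    then show "l \<in> S" using l01 by (simp add: S_def)
  qed
  \<comment> \<open>The sets \<open>U n\<close> exhaust \<open>S\<close> because \<open>r\<close> is
    positive. If none were dense in a portion of \<open>S\<close>, the complements of their closures
    would be dense and relatively open in \<open>S\<close> with empty intersection, against Baire's
    theorem.\<close>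
  define U where "U n = {t \<in> S. 1 / real (Suc n) < r t}" for n
  have "\<exists>n. \<not> S \<subseteq> closure (S - closure (U n))"
  proof (rule ccontr)
    assume neg: "\<not> ?thesis"
    have "S \<subseteq> closure (\<Inter> (range (\<lambda>n. S - closure (U n))))"
    proof (rule Baire[OF \<open>closed S\<close>])
      fix T assume "T \<in> range (\<lambda>n. S - closure (U n))"
      then obtain n where "T = S - closure (U n)" by blast
      then show "openin (top_of_set S) T \<and> S \<subseteq> closure T"
        using neg openin_open_Int[OF open_Compl[OF closed_closure], of S "U n"] by (simp add: Diff_eq)
    qed simp
    moreover have "\<Inter> (range (\<lambda>n. S - closure (U n))) = {}"
    proof -
      have "\<exists>n. t \<in> closure (U n)" if t: "t \<in> S" for t
      proof -
        have "0 < r t" using t pos by (auto simp: S_def)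
        then obtain n where "1 / real (Suc n) < r t" using nat_approx_posE by blast
        then show ?thesis using t closure_subset by (fastforce simp: U_def)
      qed
      then show ?thesis by auto
    qed
    ultimately show False using \<open>S \<noteq> {}\<close> by (metis closure_empty subset_empty)
  qed
  then obtain n p where p: "p \<in> S" "p \<notin> closure (S - closure (U n))" by blast
  then obtain \<delta> where \<delta>: "\<delta> > 0" "\<And>q. \<lbrakk>q \<in> S; \<bar>q - p\<bar> < \<delta>\<rbrakk> \<Longrightarrow> q \<in> closure (U n)"
    unfolding closure_approachable[of p "S - closure (U n)"] dist_real_def by auto
  define \<eta> where "\<eta> = 1 / real (Suc n)"
  define \<delta>' where "\<delta>' = min \<delta> (\<eta>/4)"
  have \<eta>: "\<eta> > 0" by (simp add: \<eta>_def)
  have \<delta>': "\<delta>' > 0" using \<delta> \<eta> by (simp add: \<delta>'_def)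
  \<comment> \<open>Although \<open>r q\<close> may be tiny, \<open>q\<close> is a limit of points
    \<open>u\<close> with \<open>r u > \<eta>\<close>, and one within \<open>r q\<close> of
    \<open>q\<close> has \<open>f u = f q\<close>. Such points for \<open>q\<close> and for
    \<open>p\<close> can then be compared: three distances of at most \<open>\<eta>/4\<close> add up
    to less than \<open>\<eta>\<close>.\<close>
  have nearU: "\<exists>u\<in>{0..1}. \<bar>u - q\<bar> < \<eta>/4 \<and> \<eta> < r u \<and> f u = f q" if q: "q \<in> S" "\<bar>q - p\<bar> < \<delta>'" for q
  proof -
    have q01: "q \<in> {0..1}" using q by (simp add: S_def)
    have "q \<in> closure (U n)" using \<delta>(2) q by (simp add: \<delta>'_def)
    moreover have "0 < min (\<eta>/4) (r q)" using \<eta> pos[OF q01] by simp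
    ultimately obtain u where u: "u \<in> U n" "\<bar>u - q\<bar> < min (\<eta>/4) (r q)"
      unfolding closure_approachable dist_real_def by blast
    then have "u \<in> {0..1}" "\<eta> < r u" by (auto simp: U_def S_def \<eta>_def)
    moreover have "f u = f q" using u(2) \<eta> by (intro loc q01 \<open>u \<in> {0..1}\<close>) (use \<open>\<eta> < r u\<close> in auto)
    ultimately show ?thesis using u(2) by auto
  qed
  have const: "f q = f p" if q: "q \<in> S" "\<bar>q - p\<bar> < \<delta>'" for q
  proof -
    obtain u where u: "u \<in> {0..1}" "\<bar>u - q\<bar> < \<eta>/4" "\<eta> < r u" "f u = f q" using nearU[OF q] by blast
    obtain u' where u': "u' \<in> {0..1}" "\<bar>u' - p\<bar> < \<eta>/4" "\<eta> < r u'" "f u' = f p" using nearU[of p] p(1) \<delta>' by auto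
    have "\<bar>u - u'\<bar> < \<eta>" using u(2) u'(2) q(2) unfolding \<delta>'_def by linarith
    then have "f u = f u'" using u u' by (intro loc) auto
    then show ?thesis using u u' by simp
  qed
  obtain b where b: "b \<in> {0..1}" "\<bar>b - p\<bar> < \<delta>'" "f b \<noteq> f p"
    using p(1) \<delta>' unfolding S_def by blast
  have p01: "p \<in> {0..1}" using p(1) by (simp add: S_def)
  \<comment> \<open>Let \<open>c\<close> be the point of the closure of \<open>Z\<close> nearest to
    \<open>b\<close>. If \<open>f c = f p\<close>, then \<open>seg\<close> yields a point of
    \<open>Z\<close> nearer to \<open>b\<close>; if not, \<open>c\<close> lies in \<open>S\<close>
    and so close to \<open>p\<close> that \<open>const\<close> applies.\<close>
  define Z where "Z = {t \<in> closed_segment p b. f t = f p}"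
  have seg01: "closed_segment p b \<subseteq> {0..1}"
    by (intro closed_segment_subset p01 b(1)) auto
  have "p \<in> Z" by (simp add: Z_def)
  have clZ: "closure Z \<subseteq> closed_segment p b" by (rule closure_minimal) (auto simp: Z_def)
  have "closure Z \<noteq> {}" using \<open>p \<in> Z\<close> closure_subset by blast
  then obtain c where c: "c \<in> closure Z" "\<And>z. z \<in> closure Z \<Longrightarrow> dist b c \<le> dist b z"
    using distance_attains_inf[of "closure Z" b] by blast
  have c01: "c \<in> {0..1}" using c(1) clZ seg01 by blast
  have cp: "\<bar>c - p\<bar> < \<delta>'"
  proof -
    have "dist c p \<le> dist b p" using c(1) clZ dist_in_closed_segment[of c p b] by (auto simp: dist_commute)
    then show ?thesis using b(2) by (simp add: dist_real_def)
  qed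
  have fc: "f c = f p"
  proof (rule ccontr)
    assume fc: "f c \<noteq> f p"
    have "\<exists>u\<in>{0..1}. \<bar>u - c\<bar> < \<epsilon> \<and> f u \<noteq> f c" if "\<epsilon> > 0" for \<epsilon>
    proof -
      obtain u where "u \<in> Z" "\<bar>u - c\<bar> < \<epsilon>" using c(1) \<open>\<epsilon> > 0\<close> unfolding closure_approachable dist_real_def by blast
      then show ?thesis using fc seg01 by (auto simp: Z_def)
    qed
    then have "c \<in> S" using c01 by (simp add: S_def)
    then show False using const cp fc by blast
  qed
  then have "c \<noteq> b" using b(3) by auto
  then obtain u where u: "u \<in> open_segment c b" "f u = f c" using seg[OF c01 b(1)] by blast
  have "u \<in> closed_segment p b"
  proof -
    have "closed_segment c b \<subseteq> closed_segment p b" using c(1) clZ by (auto simp: subset_closed_segment)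
    then show ?thesis using u(1) open_closed_segment by blast
  qed
  then have "u \<in> closure Z" using u(2) fc closure_subset by (fastforce simp: Z_def)
  then have "dist b c \<le> dist b u" by (rule c(2))
  then show False using dist_in_open_segment[OF u(1)] by (simp add: dist_commute)
qed

text \<open>The constant \<open>1/200\<close> is the one from \<open>superharmonic_hitting\<close>.\<close>
definition fine_disc :: "complex set \<Rightarrow> complex \<Rightarrow> real \<Rightarrow> bool" where
  "fine_disc A x r \<longleftrightarrow> 0 < r \<and>
     (\<exists>v. superharmonic_on (ball x r) v \<and> v x < ennreal (1/200) \<and> {z \<in> ball x r. v z < 1} \<subseteq> A)"

lemma fine_disc_smaller:
  assumes "fine_disc A x r" "0 < r'" "r' \<le> r"
  shows "fine_disc A x r'"
proof -
  obtain v where v: "superharmonic_on (ball x r) v" "v x < ennreal (1/200)" "{z \<in> ball x r. v z < 1} \<subseteq> A"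
    using assms(1) by (auto simp: fine_disc_def)
  have "superharmonic_on (ball x r') v"
    by (rule superharmonic_on_subset[OF v(1)]) (use assms in auto)
  moreover have "{z \<in> ball x r'. v z < 1} \<subseteq> A" using v(3) assms(3) by auto
  ultimately show ?thesis using v(2) assms(2) by (auto simp: fine_disc_def)
qed

text \<open>The end point \<open>w\<close> common to the two good segments lies in both sets. Read
  contrapositively: the centres of fine discs of disjoint sets are far apart compared to the
  radius.\<close>

lemma fine_discs_meet:
  assumes "fine_disc A x r" "fine_disc B y r" "20 * dist x y \<le> r"
  shows "A \<inter> B \<noteq> {}"
proof -
  have "0 < r" using assms(1) by (simp add: fine_disc_def)
  obtain v1 where v1: "superharmonic_on (ball x r) v1" "v1 x < ennreal (1/200)" "{z \<in> ball x r. v1 z < 1} \<subseteq> A"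
    using assms(1) by (auto simp: fine_disc_def)
  obtain v2 where v2: "superharmonic_on (ball y r) v2" "v2 y < ennreal (1/200)" "{z \<in> ball y r. v2 z < 1} \<subseteq> B"
    using assms(2) by (auto simp: fine_disc_def)
  obtain w where w: "closed_segment x w \<subseteq> {z \<in> ball x r. v1 z < 1}" "closed_segment y w \<subseteq> {z \<in> ball y r. v2 z < 1}"
    by (rule superharmonic_good_path[OF v1(1,2) v2(1,2) \<open>0 < r\<close> assms(3)])
  have "w \<in> closed_segment x w" "w \<in> closed_segment y w" by auto
  then have "w \<in> A \<inter> B" using w v1(3) v2(3) by blast
  then show ?thesis by blast
qed

text \<open>Membership in \<open>A\<close> along the segment is a function as in
  \<open>locally_comparable_imp_constant\<close>, with the radii of fine discs for \<open>r\<close>: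
  \<open>fine_discs_meet\<close> provides \<open>loc\<close> and
  \<open>superharmonic_segment_not_thin\<close> provides \<open>seg\<close>.\<close>

lemma closed_segment_finely_connected:
  fixes x y :: complex
  assumes disj: "A \<inter> B = {}" and A: "\<And>z. z \<in> A \<Longrightarrow> \<exists>r. fine_disc A z r" and B: "\<And>z. z \<in> B \<Longrightarrow> \<exists>r. fine_disc B z r"
    and seg: "closed_segment x y \<subseteq> A \<union> B" and "x \<in> A"
  shows "y \<in> A"
proof (cases "x = y")
  case False
  define d where "d = cmod (y - x)"
  have d: "d > 0" using False by (simp add: d_def)
  define \<gamma> where "\<gamma> t = x + of_real t * (y - x)" for t
  have \<gamma>: "\<gamma> t \<in> A \<union> B" if "t \<in> {0..1}" for t
  proof -
    have "\<gamma> t = (1 - t) *\<^sub>R x + t *\<^sub>R y" by (simp add: \<gamma>_def scaleR_conv_of_real algebra_simps)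
    then show ?thesis using that seg by (auto simp: closed_segment_def)
  qed
  have dist\<gamma>: "dist (\<gamma> s) (\<gamma> t) = \<bar>s - t\<bar> * d" for s t
  proof -
    have "\<gamma> s - \<gamma> t = of_real (s - t) * (y - x)" by (simp add: \<gamma>_def algebra_simps)
    then show ?thesis unfolding dist_norm d_def by (simp only: norm_mult norm_of_real)
  qed
  define f where "f t \<longleftrightarrow> \<gamma> t \<in> A" for t
  \<comment> \<open>Indexing the two sets by the truth value of \<open>f\<close> treats both sides
    at once.\<close>
  define C where "C b = (if b then A else B)" for b
  have "\<exists>r. t \<in> {0..1} \<longrightarrow> fine_disc (C (f t)) (\<gamma> t) r" for t
    using \<gamma>[of t] A B by (auto simp: C_def f_def)
  then obtain R where R: "\<And>t. t \<in> {0..1} \<Longrightarrow> fine_disc (C (f t)) (\<gamma> t) (R t)" by metis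
  have Rpos: "0 < R t" if "t \<in> {0..1}" for t using R[OF that] by (simp add: fine_disc_def)
  have inC: "f t = b" if "\<gamma> t \<in> C b" for t b
    using that disj by (auto simp: f_def C_def split: if_splits)
  have "f 0 = f 1"
  proof (rule locally_comparable_imp_constant[where r = "\<lambda>t. R t / (20 * d)"])
    fix t :: real assume "t \<in> {0..1}"
    then show "0 < R t / (20 * d)" using Rpos d by simp
  next
    fix s t :: real assume st: "s \<in> {0..1}" "t \<in> {0..1}" "\<bar>s - t\<bar> < R s / (20 * d)" "\<bar>s - t\<bar> < R t / (20 * d)"
    define m where "m = min (R s) (R t)"
    have "fine_disc (C (f s)) (\<gamma> s) m" "fine_disc (C (f t)) (\<gamma> t) m"
      using fine_disc_smaller[OF R[OF st(1)], of m] fine_disc_smaller[OF R[OF st(2)], of m] Rpos st by (auto simp: m_def)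
    moreover have "20 * dist (\<gamma> s) (\<gamma> t) \<le> m" using st d by (simp add: dist\<gamma> m_def field_simps)
    ultimately have "C (f s) \<inter> C (f t) \<noteq> {}" by (rule fine_discs_meet)
    then show "f s = f t" using disj by (auto simp: C_def split: if_splits)
  next
    fix s t :: real assume st: "s \<in> {0..1}" "t \<in> {0..1}" "s \<noteq> t"
    obtain v where v: "superharmonic_on (ball (\<gamma> s) (R s)) v" "v (\<gamma> s) < ennreal (1/200)"
      "{z \<in> ball (\<gamma> s) (R s). v z < 1} \<subseteq> C (f s)" using R[OF st(1)] by (auto simp: fine_disc_def)
    have D: "cmod (\<gamma> t - \<gamma> s) > 0" using st(3) d dist\<gamma>[of t s] by (simp add: dist_norm)
    \<comment> \<open>The bound 1/4 keeps \<open>\<tau> * \<kappa>\<close> below 1 for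
      \<open>\<tau> \<le> 2\<close>, so that the point found lies strictly between \<open>s\<close>
      and \<open>t\<close>; the other bound is the size condition of
      \<open>superharmonic_segment_not_thin\<close>.\<close>
    define \<kappa> where "\<kappa> = min (1/4) (R s / (20 * cmod (\<gamma> t - \<gamma> s)))"
    have \<kappa>: "0 < \<kappa>" "\<kappa> \<le> 1/4" "20 * cmod (of_real \<kappa> * (\<gamma> t - \<gamma> s)) \<le> R s"
    proof -
      show "0 < \<kappa>" "\<kappa> \<le> 1/4" using D Rpos[OF st(1)] by (auto simp: \<kappa>_def)
      have "\<kappa> \<le> R s / (20 * cmod (\<gamma> t - \<gamma> s))" by (simp add: \<kappa>_def)
      then show "20 * cmod (of_real \<kappa> * (\<gamma> t - \<gamma> s)) \<le> R s"
        using D \<open>0 < \<kappa>\<close> by (simp add: norm_mult pos_le_divide_eq mult_ac)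
    qed
    obtain \<tau> where \<tau>: "\<tau> \<in> {1..2}" "v (\<gamma> s + of_real \<tau> * (of_real \<kappa> * (\<gamma> t - \<gamma> s))) < 1"
      by (rule superharmonic_segment_not_thin[OF v(1) Rpos[OF st(1)] \<kappa>(3) v(2)])
    define k where "k = \<tau> * \<kappa>"
    have k: "0 < k" "k < 1" using \<tau>(1) \<kappa>(1,2) mult_mono[of \<tau> 2 \<kappa> "1/4"] by (auto simp: k_def)
    define u where "u = s + k * (t - s)"
    have \<gamma>u: "\<gamma> u = \<gamma> s + of_real \<tau> * (of_real \<kappa> * (\<gamma> t - \<gamma> s))"
      by (simp add: \<gamma>_def u_def k_def algebra_simps)
    have "cmod (of_real \<tau> * (of_real \<kappa> * (\<gamma> t - \<gamma> s))) \<le> 2 * cmod (of_real \<kappa> * (\<gamma> t - \<gamma> s))"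
      unfolding norm_mult[of "of_real \<tau>"] using \<tau>(1) by (intro mult_right_mono) auto
    also have "\<dots> < R s" using \<kappa>(3) Rpos[OF st(1)] by linarith
    finally have "\<gamma> u \<in> ball (\<gamma> s) (R s)" by (simp add: \<gamma>u dist_norm)
    then have "\<gamma> u \<in> C (f s)" using v(3) \<tau>(2) by (auto simp: \<gamma>u)
    moreover have "u \<in> open_segment s t"
      using k st(3) by (auto simp: in_segment u_def algebra_simps intro!: exI[of _ k])
    ultimately show "\<exists>u\<in>open_segment s t. f u = f s" using inC by blast
  qed
  then show ?thesis using \<open>x \<in> A\<close> by (simp add: f_def \<gamma>_def)
qed (use assms in simp)

section \<open>Plurisuperharmonic functions\<close>

lemma norm_vector_scalar_mult:
  fixes x :: "complex ^ 'n"
  shows "norm (c *s x) = cmod c * norm x"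
  by (simp add: norm_vec_def norm_mult L2_set_right_distrib)

lemma continuous_on_vector_scalar_mult [continuous_intros]:
  fixes f :: "'a::topological_space \<Rightarrow> complex" and e :: "complex ^ 'n"
  assumes "continuous_on S f"
  shows "continuous_on S (\<lambda>x. f x *s e)"
  unfolding vector_scalar_mult_def using assms by (intro continuous_intros)

definition pluri_superharmonic_on :: "(complex ^ 'n) set \<Rightarrow> (complex ^ 'n \<Rightarrow> ennreal) \<Rightarrow> bool" where
  "pluri_superharmonic_on S v \<longleftrightarrow> (\<forall>c. open {x \<in> S. c < v x}) \<and>
     (\<forall>x b. (\<forall>\<zeta>\<in>cball 0 1. x + \<zeta> *s b \<in> S) \<longrightarrow>
        (\<integral>\<^sup>+ t\<in>{0..2*pi}. v (x + cis t *s b) \<partial>lborel) \<le> ennreal (2*pi) * v x)"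

lemma pluri_superharmonic_on_subset:
  assumes "pluri_superharmonic_on S v" "open S'" "S' \<subseteq> S"
  shows "pluri_superharmonic_on S' v"
proof -
  have "{x \<in> S'. c < v x} = S' \<inter> {x \<in> S. c < v x}" for c using assms(3) by auto
  then show ?thesis using assms unfolding pluri_superharmonic_on_def by (auto simp: subset_iff)
qed

lemma pluri_superharmonic_on_line:
  assumes "pluri_superharmonic_on S v"
  shows "superharmonic_on {\<zeta>. a + \<zeta> *s e \<in> S} (\<lambda>\<zeta>. v (a + \<zeta> *s e))"
  unfolding superharmonic_on_def
proof (intro conjI allI impI)
  fix c
  have "open ((\<lambda>\<zeta>. a + \<zeta> *s e) -` {x \<in> S. c < v x})"
    using assms by (intro open_vimage continuous_intros) (auto simp: pluri_superharmonic_on_def)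
  then show "open {\<zeta> \<in> {\<zeta>. a + \<zeta> *s e \<in> S}. c < v (a + \<zeta> *s e)}" by (simp add: vimage_def)
next
  fix x b assume *: "\<forall>\<zeta>\<in>cball 0 1. x + \<zeta> * b \<in> {\<zeta>. a + \<zeta> *s e \<in> S}"
  have eq: "a + (x + \<zeta> * b) *s e = (a + x *s e) + \<zeta> *s (b *s e)" for \<zeta>
    by (simp add: vec_eq_iff algebra_simps)
  have "\<forall>\<zeta>\<in>cball 0 1. (a + x *s e) + \<zeta> *s (b *s e) \<in> S"
    using * unfolding mem_Collect_eq eq .
  then show "(\<integral>\<^sup>+ t\<in>{0..2*pi}. v (a + (x + cis t * b) *s e) \<partial>lborel) \<le> ennreal (2*pi) * v (a + x *s e)"
    unfolding eq using assms unfolding pluri_superharmonic_on_def by blast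
qed

lemma borel_measurable_lsc_circle:
  fixes v :: "complex ^ 'n \<Rightarrow> ennreal"
  assumes lsc: "\<And>c. open {x \<in> S. c < v x}" and S: "\<And>t. x + cis t *s b \<in> S"
  shows "(\<lambda>t. v (x + cis t *s b)) \<in> borel_measurable borel"
proof (rule borel_measurableI_greater)
  fix c
  have "open ((\<lambda>t. x + cis t *s b) -` {x \<in> S. c < v x})"
    by (intro open_vimage lsc continuous_intros)
  moreover have "(\<lambda>t. x + cis t *s b) -` {x \<in> S. c < v x} = {t \<in> space borel. c < v (x + cis t *s b)}"
    using S by auto
  ultimately show "{t \<in> space borel. c < v (x + cis t *s b)} \<in> sets borel" by simp
qed

lemma pluri_superharmonic_on_add:
  assumes u: "pluri_superharmonic_on S u" and v: "pluri_superharmonic_on S v"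
  shows "pluri_superharmonic_on S (\<lambda>z. u z + v z)"
  unfolding pluri_superharmonic_on_def
proof (intro conjI allI impI)
  fix c
  have "openin euclidean {x \<in> S. c < u x + v x}"
    by (rule openin_less_add_ennreal) (use u v in \<open>auto simp: pluri_superharmonic_on_def\<close>)
  then show "open {x \<in> S. c < u x + v x}" by simp
next
  fix x b assume *: "\<forall>\<zeta>\<in>cball 0 1. x + \<zeta> *s b \<in> S"
  then have S: "x + cis t *s b \<in> S" for t by simp
  have m: "(\<lambda>t. u (x + cis t *s b)) \<in> borel_measurable borel" "(\<lambda>t. v (x + cis t *s b)) \<in> borel_measurable borel"
    using u v by (auto intro!: borel_measurable_lsc_circle[OF _ S] simp: pluri_superharmonic_on_def)
  have "(\<integral>\<^sup>+ t\<in>{0..2*pi}. u (x + cis t *s b) + v (x + cis t *s b) \<partial>lborel) =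
      (\<integral>\<^sup>+ t\<in>{0..2*pi}. u (x + cis t *s b) \<partial>lborel) + (\<integral>\<^sup>+ t\<in>{0..2*pi}. v (x + cis t *s b) \<partial>lborel)"
    unfolding distrib_right using m by (intro nn_integral_add) auto
  also have "\<dots> \<le> ennreal (2*pi) * u x + ennreal (2*pi) * v x"
    using u v * unfolding pluri_superharmonic_on_def by (intro add_mono) auto
  finally show "(\<integral>\<^sup>+ t\<in>{0..2*pi}. u (x + cis t *s b) + v (x + cis t *s b) \<partial>lborel) \<le> ennreal (2*pi) * (u x + v x)"
    by (simp add: distrib_left)
qed

section \<open>From plurisubharmonic to nonnegative plurisuperharmonic functions\<close>

lemma usc_on_subset_open:
  assumes "usc_on \<Omega> \<phi>" "open S" "S \<subseteq> \<Omega>"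
  shows "open {z \<in> S. \<phi> z < c}"
proof -
  obtain T where T: "open T" "{x \<in> \<Omega>. \<phi> x < c} = \<Omega> \<inter> T"
    using assms(1) unfolding usc_on_def openin_open by blast
  then have "{z \<in> S. \<phi> z < c} = S \<inter> T" using assms(3) by auto
  then show ?thesis using T(1) assms(2) by auto
qed

lemma plurisubharmonic_circle:
  assumes "plurisubharmonic_on \<Omega> \<phi>" "\<forall>\<zeta>\<in>cball 0 1. x + \<zeta> *s b \<in> \<Omega>"
  shows "\<phi> x \<le> (enn2ereal (\<integral>\<^sup>+ t\<in>{0..2*pi}. e2ennreal (\<phi> (x + cis t *s b)) \<partial>lborel)
      - enn2ereal (\<integral>\<^sup>+ t\<in>{0..2*pi}. e2ennreal (- \<phi> (x + cis t *s b)) \<partial>lborel)) / ereal (2 * pi)"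
proof -
  have "subharmonic_on {\<zeta>. x + \<zeta> *s b \<in> \<Omega>} (\<lambda>\<zeta>. \<phi> (x + \<zeta> *s b))"
    using assms(1) by (simp add: plurisubharmonic_on_def)
  moreover have "cball 0 1 \<subseteq> {\<zeta>. x + \<zeta> *s b \<in> \<Omega>}" using assms(2) by auto
  ultimately have "\<phi> (x + 0 *s b) \<le> circle_mean (\<lambda>\<zeta>. \<phi> (x + \<zeta> *s b)) 0 1"
    unfolding subharmonic_on_def using zero_less_one by blast
  then show ?thesis by (simp add: circle_mean_def)
qed

text \<open>On \<open>S\<close> the function \<open>K - \<phi>\<close> is positive and lower
  semicontinuous. The work lies in the mean value inequality: \<open>circle_mean\<close> is a
  difference of integrals of the positive and negative parts, the claim concerns a single
  \<open>ennreal\<close> integral, and \<open>\<phi>\<close> may be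
  \<open>-\<infinity>\<close>.\<close>

lemma pluri_superharmonic_of_plurisubharmonic:
  fixes K \<kappa> :: real
  assumes psh: "plurisubharmonic_on \<Omega> \<phi>" and S: "open S" "S \<subseteq> \<Omega>" and K: "\<And>z. z \<in> S \<Longrightarrow> \<phi> z < ereal K" and "0 < \<kappa>"
  shows "pluri_superharmonic_on S (\<lambda>z. ennreal (1/\<kappa>) * e2ennreal (ereal K - \<phi> z))"
  unfolding pluri_superharmonic_on_def
proof (intro conjI allI impI)
  have usc: "usc_on \<Omega> \<phi>" using psh by (simp add: plurisubharmonic_on_def)
  fix c
  show "open {x \<in> S. c < ennreal (1/\<kappa>) * e2ennreal (ereal K - \<phi> x)}"
  proof (cases c)
    case (real c')
    have "c < ennreal (1/\<kappa>) * e2ennreal (ereal K - \<phi> x) \<longleftrightarrow> \<phi> x < ereal (K - \<kappa> * c')" if "x \<in> S" for x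
    proof (cases "\<phi> x")
      case (real p)
      then have "p < K" using K[OF that] by simp
      then show ?thesis using real \<open>c = ennreal c'\<close> \<open>0 \<le> c'\<close> \<open>0 < \<kappa>\<close>
        by (simp add: ennreal_less_iff field_simps flip: ennreal_mult'')
    next
      case MInf
      then show ?thesis using \<open>c = ennreal c'\<close> \<open>0 < \<kappa>\<close> by (simp add: ennreal_mult_top)
    qed (use K[OF that] in auto)
    then have "{x \<in> S. c < ennreal (1/\<kappa>) * e2ennreal (ereal K - \<phi> x)} = {x \<in> S. \<phi> x < ereal (K - \<kappa> * c')}" by auto
    then show ?thesis using usc_on_subset_open[OF usc S] by simp
  qed simp
next
  fix x b assume *: "\<forall>\<zeta>\<in>cball 0 1. x + \<zeta> *s b \<in> S"
  define u where "u t = \<phi> (x + cis t *s b)" for t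
  have inS: "x + cis t *s b \<in> S" for t using * by simp
  have "x \<in> S" using bspec[OF *, of 0] by simp
  have uK: "u t < ereal K" for t unfolding u_def by (rule K[OF inS])
  have meas[measurable]: "u \<in> borel_measurable borel"
  proof (rule borel_measurableI_less)
    fix c
    have "open ((\<lambda>t. x + cis t *s b) -` {z \<in> S. \<phi> z < c})"
      using psh by (intro open_vimage usc_on_subset_open[OF _ S] continuous_intros) (simp add: plurisubharmonic_on_def)
    moreover have "(\<lambda>t. x + cis t *s b) -` {z \<in> S. \<phi> z < c} = {t \<in> space borel. u t < c}"
      using inS by (auto simp: u_def)
    ultimately show "{t \<in> space borel. u t < c} \<in> sets borel" by simp
  qed
  define A P N where "A = (\<integral>\<^sup>+ t\<in>{0..2*pi}. e2ennreal (ereal K - u t) \<partial>lborel)"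
    and "P = (\<integral>\<^sup>+ t\<in>{0..2*pi}. e2ennreal (u t) \<partial>lborel)"
    and "N = (\<integral>\<^sup>+ t\<in>{0..2*pi}. e2ennreal (- u t) \<partial>lborel)"
  have sub: "\<phi> x \<le> (enn2ereal P - enn2ereal N) / ereal (2*pi)"
    unfolding P_def N_def u_def using S * by (intro plurisubharmonic_circle[OF psh]) auto
  \<comment> \<open>Splitting \<open>K\<close> and \<open>u\<close> into positive and negative
    parts, this is \<open>K - u\<close> with every subtracted part moved to the other side. It
    remains true for \<open>u t = -\<infinity>\<close>, where both sides are infinite.\<close>
  have pw: "e2ennreal (ereal K - u t) + e2ennreal (u t) + ennreal (- K) = ennreal K + e2ennreal (- u t)" for t
  proof (cases "u t")
    case (real p)
    then have "p < K" using uK[of t] by simp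
    then show ?thesis unfolding real
      by (cases "0 \<le> K"; cases "0 \<le> p") (auto simp: ennreal_neg simp flip: ennreal_plus)
  qed (use uK[of t] in auto)
  have const: "(\<integral>\<^sup>+ t\<in>{0..2*pi}. ennreal c \<partial>lborel) = ennreal (2*pi) * ennreal c" for c
    by (simp add: nn_integral_cmult_indicator mult.commute)
  have "A + P + ennreal (2*pi) * ennreal (- K) =
     (\<integral>\<^sup>+ t\<in>{0..2*pi}. (e2ennreal (ereal K - u t) + e2ennreal (u t) + ennreal (- K)) \<partial>lborel)"
    unfolding A_def P_def distrib_right const[symmetric] by (simp add: nn_integral_add)
  also have "\<dots> = ennreal (2*pi) * ennreal K + N"
    unfolding pw N_def distrib_right const[symmetric] by (simp add: nn_integral_add)
  finally have int: "A + P + ennreal (2*pi) * ennreal (- K) = ennreal (2*pi) * ennreal K + N" .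
  \<comment> \<open>The bound \<open>u < K\<close> makes \<open>P\<close> finite. Hence the
    difference in \<open>sub\<close> is a genuine one, and an infinite \<open>N\<close> would force
    \<open>\<phi> x = -\<infinity>\<close>.\<close>
  have "P \<le> (\<integral>\<^sup>+ t\<in>{0..2*pi}. ennreal K \<partial>lborel)"
    unfolding P_def
    by (intro nn_integral_mono mult_right_mono)
      (auto simp flip: e2ennreal_ereal intro!: e2ennreal_mono uK[THEN less_imp_le])
  then have "P < top" unfolding const by (simp add: order_le_less_trans ennreal_mult_less_top)
  then obtain P' where P': "0 \<le> P'" "P = ennreal P'" by (metis ennreal_cases less_irrefl)
  have A: "A \<le> ennreal (2*pi) * e2ennreal (ereal K - \<phi> x)"
  proof (cases "\<phi> x = -\<infinity>")
    case True
    then show ?thesis by (simp add: ennreal_mult_top)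
  next
    case False
    then obtain p where p: "\<phi> x = ereal p" "p < K" using K[OF \<open>x \<in> S\<close>] by (cases "\<phi> x") auto
    have "N \<noteq> top" using sub p P' by (auto simp: enn2ereal_ennreal)
    then obtain N' where N': "0 \<le> N'" "N = ennreal N'" by (metis ennreal_cases)
    have "p \<le> (P' - N') / (2*pi)" using sub p P' N' by (simp add: enn2ereal_ennreal)
    then have pl: "p * (2*pi) \<le> P' - N'" by (simp add: pos_le_divide_eq)
    have "A \<le> ennreal (2*pi) * ennreal K + N" unfolding int[symmetric] by (simp add: add.assoc)
    also have "\<dots> < top" using N' by (simp add: ennreal_mult_less_top)
    finally have "A \<noteq> top" by simp
    then obtain A' where A': "0 \<le> A'" "A = ennreal A'" by (metis ennreal_cases)
    have "A' + P' \<le> 2*pi*K + N'"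
    proof (cases "0 \<le> K")
      case True
      then show ?thesis using int A' P' N' by (simp add: ennreal_neg flip: ennreal_plus ennreal_mult'')
    next
      case False
      define c where "c = 2*pi*(-K)"
      have "0 \<le> c" unfolding c_def using False by (intro mult_nonneg_nonneg) auto
      have "ennreal (2*pi) * ennreal (-K) = ennreal c"
        unfolding c_def using False by (intro ennreal_mult''[symmetric]) auto
      then have "ennreal (A' + P' + c) = ennreal N'"
        using int A' P' N' False \<open>0 \<le> c\<close> by (simp add: ennreal_neg)
      then have "A' + P' + c = N'" using A'(1) P'(1) N'(1) \<open>0 \<le> c\<close> by (subst (asm) ennreal_inj) auto
      then show ?thesis by (simp add: c_def algebra_simps)
    qed
    then have "A' \<le> 2*pi*(K - p)" using pl by (simp add: algebra_simps)
    then show ?thesis using A' p by (simp add: ennreal_leI flip: ennreal_mult'')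
  qed
  have "(\<integral>\<^sup>+ t\<in>{0..2*pi}. (ennreal (1/\<kappa>) * e2ennreal (ereal K - \<phi> (x + cis t *s b))) \<partial>lborel) = ennreal (1/\<kappa>) * A"
    unfolding A_def u_def[symmetric] mult.assoc by (simp add: nn_integral_cmult)
  also have "\<dots> \<le> ennreal (1/\<kappa>) * (ennreal (2*pi) * e2ennreal (ereal K - \<phi> x))"
    by (rule mult_left_mono[OF A]) simp
  finally show "(\<integral>\<^sup>+ t\<in>{0..2*pi}. (ennreal (1/\<kappa>) * e2ennreal (ereal K - \<phi> (x + cis t *s b))) \<partial>lborel)
      \<le> ennreal (2*pi) * (ennreal (1/\<kappa>) * e2ennreal (ereal K - \<phi> x))"
    by (simp add: mult.left_commute)
qed

text \<open>This makes Euclidean balls pluri-finely open. On a circle the squared norm is a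
  constant, at least its value at the centre, plus a linear combination of \<open>cos\<close> and
  \<open>sin\<close>, whose mean vanishes.\<close>

lemma plurisubharmonic_on_norm_sq:
  fixes a :: "complex ^ 'n"
  shows "plurisubharmonic_on \<Omega> (\<lambda>z. ereal ((norm (z - a))\<^sup>2))"
proof -
  have usc: "usc_on S (\<lambda>z. ereal (k z))" if "continuous_on S k" for S :: "'b::topological_space set" and k
    unfolding usc_on_def
  proof
    fix c
    have "continuous_on S (\<lambda>z. ereal (k z))" using that by (intro continuous_intros)
    then have "openin (top_of_set S) (S \<inter> (\<lambda>z. ereal (k z)) -` {..<c})"
      by (rule continuous_openin_preimage_gen) auto
    then show "openin (top_of_set S) {x \<in> S. ereal (k x) < c}" by (simp add: vimage_def Int_def)
  qed
  have mean: "ereal ((norm (p + c *s b - a))\<^sup>2) \<le> circle_mean (\<lambda>\<zeta>. ereal ((norm (p + \<zeta> *s b - a))\<^sup>2)) c r" for p b c r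
  proof -
    define y where "y = p + c *s b - a"
    define d where "d = of_real r *s b"
    have eq: "p + (c + of_real r * \<zeta>) *s b - a = y + \<zeta> *s d" for \<zeta>
      by (simp add: y_def d_def vec_eq_iff algebra_simps)
    define k where "k t = (norm (y + cis t *s d))\<^sup>2" for t
    define A B where "A = inner y d" and "B = inner y (\<i> *s d)"
    have cont: "continuous_on {0..2*pi} k" unfolding k_def by (intro continuous_intros)
    have cis: "cis t *s d = cos t *\<^sub>R d + sin t *\<^sub>R (\<i> *s d)" for t
      by (simp add: vec_eq_iff complex_eq_iff)
    have lower: "(norm y)\<^sup>2 + 2 * A * cos t + 2 * B * sin t \<le> k t" for t
    proof -
      have "k t = (norm y)\<^sup>2 + 2 * inner y (cis t *s d) + (norm (cis t *s d))\<^sup>2"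
        unfolding k_def by (simp add: power2_norm_eq_inner inner_add_left inner_add_right inner_commute)
      moreover have "inner y (cis t *s d) = A * cos t + B * sin t"
        unfolding cis by (simp add: A_def B_def inner_add_right)
      ultimately show ?thesis by simp
    qed
    have "((\<lambda>t. (norm y)\<^sup>2 + 2 * A * cos t + 2 * B * sin t) has_integral
        ((norm y)\<^sup>2 * (2*pi) + 2 * A * sin (2*pi) - 2 * B * cos (2*pi)) -
        ((norm y)\<^sup>2 * 0 + 2 * A * sin 0 - 2 * B * cos 0)) {0..2*pi}"
      by (rule fundamental_theorem_of_calculus)
        (auto intro!: derivative_eq_intros simp flip: has_real_derivative_iff_has_vector_derivative)
    then have "(norm y)\<^sup>2 * (2*pi) \<le> integral {0..2*pi} k"
      using lower by (intro has_integral_le[OF _ integrable_integral[OF integrable_continuous_real[OF cont]]]) auto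
    moreover have "circle_mean (\<lambda>\<zeta>. ereal ((norm (p + \<zeta> *s b - a))\<^sup>2)) c r = ereal (integral {0..2*pi} k / (2*pi))"
    proof -
      have "(\<integral>\<^sup>+ t\<in>{0..2*pi}. ennreal (k t) \<partial>lborel) = ennreal (integral {0..2*pi} k)"
        by (intro nn_integral_has_integral_lebesgue' integrable_integral integrable_continuous_real cont) (simp add: k_def)
      moreover have "e2ennreal (- ereal (k t)) = 0" for t by (simp add: k_def ennreal_neg)
      moreover have "0 \<le> integral {0..2*pi} k" by (rule integral_nonneg[OF integrable_continuous_real[OF cont]]) (simp add: k_def)
      ultimately show ?thesis
        unfolding circle_mean_def eq k_def[symmetric] by (simp add: enn2ereal_ennreal zero_ennreal.rep_eq)
    qed
    ultimately show ?thesis unfolding y_def[symmetric] by (simp add: field_simps)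
  qed
  show ?thesis
    unfolding plurisubharmonic_on_def subharmonic_on_def using mean
    by (auto intro!: usc continuous_intros)
qed

lemma openin_pluri_fine_preimage:
  assumes "plurisubharmonic_on \<Omega> \<phi>" "open U"
  shows "openin (pluri_fine_topology \<Omega>) {z \<in> \<Omega>. \<phi> z \<in> U}"
  unfolding pluri_fine_topology_def using assms by (intro topology_generated_by_Basis) auto

lemma openin_pluri_fine_ball:
  assumes "ball a r \<subseteq> \<Omega>"
  shows "openin (pluri_fine_topology \<Omega>) (ball a r)"
proof (cases "0 < r")
  case True
  have "openin (pluri_fine_topology \<Omega>) {z \<in> \<Omega>. ereal ((norm (z - a))\<^sup>2) \<in> {..<ereal (r\<^sup>2)}}"
    by (intro openin_pluri_fine_preimage plurisubharmonic_on_norm_sq) simp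
  moreover have "{z \<in> \<Omega>. ereal ((norm (z - a))\<^sup>2) \<in> {..<ereal (r\<^sup>2)}} = ball a r"
    using assms True by (auto simp: dist_norm norm_minus_commute power2_less_imp_less intro!: power_strict_mono)
  ultimately show ?thesis by simp
qed (simp add: ball_empty not_less)

section \<open>Pluri-fine neighbourhoods and quasi-components\<close>

text \<open>Quasi-components are easier to control than components: two points share one as soon as
  no separation of \<open>W\<close> into two open sets splits them. When all quasi-components are
  open, they are the components, and components of open sets are then open.\<close>

lemma locally_connected_space_quasi_component:
  assumes "\<And>W x. \<lbrakk>openin X W; x \<in> W\<rbrakk> \<Longrightarrow>
    \<exists>N. openin X N \<and> x \<in> N \<and> N \<subseteq> quasi_component_of_set (subtopology X W) x"
  shows "locally_connected_space X"
  unfolding locally_connected_space_open_connected_components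
proof clarify
  fix W C assume W: "openin X W" and C: "C \<in> connected_components_of (subtopology X W)"
  have sub: "topspace (subtopology X W) = W" using openin_subset[OF W] by auto
  have op: "openin X (quasi_component_of_set (subtopology X W) x)" for x
  proof (subst openin_subopen, clarify)
    fix y assume y: "quasi_component_of (subtopology X W) x y"
    then have "y \<in> W" using quasi_component_in_topspace[OF y] sub by simp
    then obtain N where "openin X N" "y \<in> N" "N \<subseteq> quasi_component_of_set (subtopology X W) y"
      using assms[OF W] by blast
    moreover have "quasi_component_of_set (subtopology X W) y \<subseteq> quasi_component_of_set (subtopology X W) x"
      by (auto intro: quasi_component_of_trans[OF y])
    ultimately show "\<exists>T. openin X T \<and> y \<in> T \<and> T \<subseteq> quasi_component_of_set (subtopology X W) x" by blast
  qed
  then have "openin (subtopology X W) Q" if "Q \<in> quasi_components_of (subtopology X W)" for Q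
    using that W quasi_component_of_subset_topspace[of "subtopology X W"] sub
    by (auto simp: quasi_components_of_def openin_open_subtopology)
  then have "quasi_components_of (subtopology X W) \<subseteq> connected_components_of (subtopology X W)"
    using open_quasi_eq_connected_components_of by blast
  then have "C \<in> quasi_components_of (subtopology X W)"
    using quasi_eq_connected_components_of_inclusion C by blast
  then show "openin X C" using op by (auto simp: quasi_components_of_def)
qed

text \<open>
  The witness \<open>v\<close> lives on a ball only, so that it need not be continuous in the pluri-fine
  topology of \<open>\<Omega>\<close>; the set \<open>N\<close> makes up for this.
\<close>
definition fine_neighbourhood :: "(complex ^ 'n) set \<Rightarrow> (complex ^ 'n) set \<Rightarrow> complex ^ 'n \<Rightarrow> bool" where
  "fine_neighbourhood \<Omega> W z \<longleftrightarrow> (\<forall>\<eta>>0. \<exists>r>0. \<exists>v N. ball z r \<subseteq> \<Omega> \<and> pluri_superharmonic_on (ball z r) v \<and>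
     {\<xi> \<in> ball z r. v \<xi> < 1} \<subseteq> W \<and>
     openin (pluri_fine_topology \<Omega>) N \<and> z \<in> N \<and> N \<subseteq> ball z r \<and> (\<forall>\<xi>\<in>N. v \<xi> < ennreal \<eta>))"

lemma fine_neighbourhood_mono:
  assumes "fine_neighbourhood \<Omega> W z" "W \<subseteq> W'"
  shows "fine_neighbourhood \<Omega> W' z"
  unfolding fine_neighbourhood_def
proof (intro allI impI)
  fix \<eta> :: real assume "\<eta> > 0"
  then obtain r v N where *: "r > 0" "ball z r \<subseteq> \<Omega>" "pluri_superharmonic_on (ball z r) v"
    "{\<xi> \<in> ball z r. v \<xi> < 1} \<subseteq> W" "openin (pluri_fine_topology \<Omega>) N" "z \<in> N" "N \<subseteq> ball z r"
    "\<forall>\<xi>\<in>N. v \<xi> < ennreal \<eta>"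
    using assms(1) unfolding fine_neighbourhood_def by meson
  have "{\<xi> \<in> ball z r. v \<xi> < 1} \<subseteq> W'" using *(4) assms(2) by (rule subset_trans)
  then show "\<exists>r>0. \<exists>v N. ball z r \<subseteq> \<Omega> \<and> pluri_superharmonic_on (ball z r) v \<and>
     {\<xi> \<in> ball z r. v \<xi> < 1} \<subseteq> W' \<and>
     openin (pluri_fine_topology \<Omega>) N \<and> z \<in> N \<and> N \<subseteq> ball z r \<and> (\<forall>\<xi>\<in>N. v \<xi> < ennreal \<eta>)"
    using * by blast
qed

text \<open>The sum of the two witnesses serves for the intersection, since it is below 1 only where
  both are. Smallness is preserved because each witness can be chosen for
  \<open>\<eta>/2\<close>.\<close>

lemma fine_neighbourhood_Int:
  assumes "fine_neighbourhood \<Omega> W1 z" "fine_neighbourhood \<Omega> W2 z"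
  shows "fine_neighbourhood \<Omega> (W1 \<inter> W2) z"
  unfolding fine_neighbourhood_def
proof (intro allI impI)
  fix \<eta> :: real assume "\<eta> > 0"
  then have h: "\<eta>/2 > 0" by simp
  obtain r1 v1 N1 where 1: "r1 > 0" "ball z r1 \<subseteq> \<Omega>" "pluri_superharmonic_on (ball z r1) v1"
    "{\<xi> \<in> ball z r1. v1 \<xi> < 1} \<subseteq> W1" "openin (pluri_fine_topology \<Omega>) N1" "z \<in> N1" "N1 \<subseteq> ball z r1"
    "\<forall>\<xi>\<in>N1. v1 \<xi> < ennreal (\<eta>/2)"
    using assms(1) h unfolding fine_neighbourhood_def by meson
  obtain r2 v2 N2 where 2: "r2 > 0" "ball z r2 \<subseteq> \<Omega>" "pluri_superharmonic_on (ball z r2) v2"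
    "{\<xi> \<in> ball z r2. v2 \<xi> < 1} \<subseteq> W2" "openin (pluri_fine_topology \<Omega>) N2" "z \<in> N2" "N2 \<subseteq> ball z r2"
    "\<forall>\<xi>\<in>N2. v2 \<xi> < ennreal (\<eta>/2)"
    using assms(2) h unfolding fine_neighbourhood_def by meson
  define r where "r = min r1 r2"
  define v where "v \<xi> = v1 \<xi> + v2 \<xi>" for \<xi>
  have "pluri_superharmonic_on (ball z r) v"
    unfolding v_def using 1(3) 2(3)
    by (intro pluri_superharmonic_on_add) (auto intro: pluri_superharmonic_on_subset simp: r_def)
  moreover have "{\<xi> \<in> ball z r. v \<xi> < 1} \<subseteq> W1 \<inter> W2"
  proof
    fix \<xi> assume \<xi>: "\<xi> \<in> {\<xi> \<in> ball z r. v \<xi> < 1}"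
    have "v1 \<xi> \<le> v \<xi>" "v2 \<xi> \<le> v \<xi>" by (simp_all add: v_def)
    then have "v1 \<xi> < 1" "v2 \<xi> < 1" using \<xi> by (auto intro: order_le_less_trans)
    then show "\<xi> \<in> W1 \<inter> W2" using \<xi> 1(4) 2(4) by (auto simp: r_def)
  qed
  moreover have "v \<xi> < ennreal \<eta>" if "\<xi> \<in> N1 \<inter> N2" for \<xi>
  proof -
    have "v \<xi> < ennreal (\<eta>/2 + \<eta>/2)" unfolding v_def using that 1(8) 2(8) by (intro add_mono_ennreal) auto
    then show ?thesis by simp
  qed
  moreover have "openin (pluri_fine_topology \<Omega>) (N1 \<inter> N2)" using 1(5) 2(5) by (rule openin_Int)
  moreover have "z \<in> N1 \<inter> N2" using 1(6) 2(6) by blast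
  moreover have "ball z r = ball z r1 \<inter> ball z r2" by (auto simp: r_def)
  then have "N1 \<inter> N2 \<subseteq> ball z r" "ball z r \<subseteq> \<Omega>" using 1(2,7) 2(7) by blast+
  moreover have "r > 0" using 1(1) 2(1) by (simp add: r_def)
  ultimately show "\<exists>r>0. \<exists>v N. ball z r \<subseteq> \<Omega> \<and> pluri_superharmonic_on (ball z r) v \<and>
     {\<xi> \<in> ball z r. v \<xi> < 1} \<subseteq> W1 \<inter> W2 \<and>
     openin (pluri_fine_topology \<Omega>) N \<and> z \<in> N \<and> N \<subseteq> ball z r \<and> (\<forall>\<xi>\<in>N. v \<xi> < ennreal \<eta>)"
    by blast
qed

lemma fine_neighbourhood_ball:
  assumes "0 < r" "ball z r \<subseteq> \<Omega>"
  shows "fine_neighbourhood \<Omega> (ball z r) z"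
  unfolding fine_neighbourhood_def
proof (intro allI impI)
  fix \<eta> :: real assume "\<eta> > 0"
  have "open {x \<in> ball z r. c < (0::ennreal)}" for c by simp
  then have "pluri_superharmonic_on (ball z r) (\<lambda>_. 0)" by (simp add: pluri_superharmonic_on_def)
  then show "\<exists>r'>0. \<exists>v N. ball z r' \<subseteq> \<Omega> \<and> pluri_superharmonic_on (ball z r') v \<and>
     {\<xi> \<in> ball z r'. v \<xi> < 1} \<subseteq> ball z r \<and>
     openin (pluri_fine_topology \<Omega>) N \<and> z \<in> N \<and> N \<subseteq> ball z r' \<and> (\<forall>\<xi>\<in>N. v \<xi> < ennreal \<eta>)"
    using assms openin_pluri_fine_ball[OF assms(2)] \<open>\<eta> > 0\<close>
    by (intro exI[of _ r] exI[of _ "\<lambda>_. 0"] exI[of _ "ball z r"] conjI) auto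
qed

text \<open>For \<open>K\<close> slightly above \<open>p\<close>, the witness
  \<open>(K - \<phi>) / \<epsilon>\<close> is below 1 exactly where
  \<open>\<phi> > K - \<epsilon>\<close>, and \<open>K - \<epsilon>\<close> exceeds
  \<open>p - \<epsilon>\<close>.\<close>

lemma fine_neighbourhood_superlevel:
  fixes p \<epsilon> :: real
  assumes psh: "plurisubharmonic_on \<Omega> \<phi>" and "open \<Omega>" "z \<in> \<Omega>" and p: "\<phi> z = ereal p" and \<epsilon>: "\<epsilon> > 0"
  shows "fine_neighbourhood \<Omega> {\<xi> \<in> \<Omega>. ereal (p - \<epsilon>) < \<phi> \<xi>} z"
  unfolding fine_neighbourhood_def
proof (intro allI impI)
  fix \<eta> :: real assume "\<eta> > 0"
  have usc: "usc_on \<Omega> \<phi>" using psh by (simp add: plurisubharmonic_on_def)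
  \<comment> \<open>\<open>K > p\<close> lets upper semicontinuity provide a ball on which
    \<open>\<phi> < K\<close>; \<open>K - p \<le> \<eta> * \<epsilon> / 2\<close> makes the witness
    at most \<open>\<eta>/2\<close> at \<open>z\<close>.\<close>
  define K where "K = p + min (\<epsilon>/2) (\<eta> * \<epsilon> / 2)"
  have K: "p < K" "K \<le> p + \<epsilon>/2" "K \<le> p + \<eta> * \<epsilon> / 2" using \<epsilon> \<open>\<eta> > 0\<close> by (auto simp: K_def)
  have "open {\<xi> \<in> \<Omega>. \<phi> \<xi> < ereal K}" by (rule usc_on_subset_open[OF usc \<open>open \<Omega>\<close> order_refl])
  moreover have "z \<in> {\<xi> \<in> \<Omega>. \<phi> \<xi> < ereal K}" using assms K by simp
  ultimately obtain r where r: "r > 0" "ball z r \<subseteq> {\<xi> \<in> \<Omega>. \<phi> \<xi> < ereal K}"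
    by (meson open_contains_ball)
  have r\<Omega>: "ball z r \<subseteq> \<Omega>" and rK: "\<And>\<xi>. \<xi> \<in> ball z r \<Longrightarrow> \<phi> \<xi> < ereal K" using r by auto
  define v where "v \<xi> = ennreal (1/\<epsilon>) * e2ennreal (ereal K - \<phi> \<xi>)" for \<xi>
  have v: "pluri_superharmonic_on (ball z r) v"
    unfolding v_def by (rule pluri_superharmonic_of_plurisubharmonic[OF psh _ r\<Omega> rK \<epsilon>]) auto
  have vless: "v \<xi> < ennreal c \<longleftrightarrow> ereal (K - \<epsilon> * c) < \<phi> \<xi>" if "\<xi> \<in> ball z r" "0 \<le> c" for \<xi> c
  proof (cases "\<phi> \<xi>")
    case (real q)
    then have "q < K" using rK[OF that(1)] by simp
    then show ?thesis using \<open>0 \<le> c\<close> \<epsilon> real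
      by (simp add: v_def ennreal_less_iff field_simps flip: ennreal_mult'')
  next
    case MInf
    then show ?thesis using \<epsilon> by (simp add: v_def ennreal_mult_top)
  qed (use rK[OF that(1)] in auto)
  \<comment> \<open>On the ball, \<open>v < \<eta>\<close> means
    \<open>\<phi> > K - \<epsilon> * \<eta>\<close>. This condition is pluri-finely open because
    \<open>\<phi>\<close> is plurisubharmonic on all of \<open>\<Omega>\<close>.\<close>
  define N where "N = {\<xi> \<in> \<Omega>. \<phi> \<xi> \<in> {ereal (K - \<epsilon> * \<eta>)<..}} \<inter> ball z r"
  have "openin (pluri_fine_topology \<Omega>) {\<xi> \<in> \<Omega>. \<phi> \<xi> \<in> {ereal (K - \<epsilon> * \<eta>)<..}}"
    by (intro openin_pluri_fine_preimage psh) simp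
  then have N: "openin (pluri_fine_topology \<Omega>) N"
    unfolding N_def by (intro openin_Int openin_pluri_fine_ball r\<Omega>)
  have "0 < \<eta> * \<epsilon>" using \<epsilon> \<open>\<eta> > 0\<close> by simp
  then have "K - \<epsilon> * \<eta> < p" using K(3) by (simp add: mult.commute)
  then have "z \<in> N" using p \<open>z \<in> \<Omega>\<close> r(1) by (simp add: N_def)
  moreover have "\<forall>\<xi>\<in>N. v \<xi> < ennreal \<eta>" using vless \<open>\<eta> > 0\<close> by (auto simp: N_def)
  moreover have "{\<xi> \<in> ball z r. v \<xi> < 1} \<subseteq> {\<xi> \<in> \<Omega>. ereal (p - \<epsilon>) < \<phi> \<xi>}"
  proof clarify
    fix \<xi> assume \<xi>: "\<xi> \<in> ball z r" "v \<xi> < 1"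
    then have "ereal (K - \<epsilon>) < \<phi> \<xi>" using vless[of \<xi> 1] by simp
    moreover have "ereal (p - \<epsilon>) \<le> ereal (K - \<epsilon>)" using K(1) by simp
    ultimately have "ereal (p - \<epsilon>) < \<phi> \<xi>" by order
    then show "\<xi> \<in> \<Omega> \<and> ereal (p - \<epsilon>) < \<phi> \<xi>" using \<xi> r\<Omega> by blast
  qed
  moreover have "N \<subseteq> ball z r" by (auto simp: N_def)
  ultimately show "\<exists>r>0. \<exists>v N. ball z r \<subseteq> \<Omega> \<and> pluri_superharmonic_on (ball z r) v \<and>
     {\<xi> \<in> ball z r. v \<xi> < 1} \<subseteq> {\<xi> \<in> \<Omega>. ereal (p - \<epsilon>) < \<phi> \<xi>} \<and>
     openin (pluri_fine_topology \<Omega>) N \<and> z \<in> N \<and> N \<subseteq> ball z r \<and> (\<forall>\<xi>\<in>N. v \<xi> < ennreal \<eta>)"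
    using r(1) r\<Omega> v N by blast
qed

text \<open>Upper semicontinuity makes the sublevel set open in the Euclidean sense, so it contains
  a ball about \<open>z\<close>.\<close>

lemma fine_neighbourhood_sublevel:
  assumes psh: "plurisubharmonic_on \<Omega> \<phi>" and "open \<Omega>" "z \<in> \<Omega>" "\<phi> z < c"
  shows "fine_neighbourhood \<Omega> {\<xi> \<in> \<Omega>. \<phi> \<xi> < c} z"
proof -
  have "open {\<xi> \<in> \<Omega>. \<phi> \<xi> < c}"
    using psh \<open>open \<Omega>\<close> by (intro usc_on_subset_open) (auto simp: plurisubharmonic_on_def)
  moreover have "z \<in> {\<xi> \<in> \<Omega>. \<phi> \<xi> < c}" using assms by simp
  ultimately obtain r where r: "r > 0" "ball z r \<subseteq> {\<xi> \<in> \<Omega>. \<phi> \<xi> < c}" by (meson open_contains_ball)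
  then have "fine_neighbourhood \<Omega> (ball z r) z" by (intro fine_neighbourhood_ball) auto
  then show ?thesis using r(2) by (rule fine_neighbourhood_mono)
qed

lemma openin_pluri_fine_imp_fine_neighbourhood:
  assumes "open \<Omega>" "openin (pluri_fine_topology \<Omega>) W" "z \<in> W"
  shows "fine_neighbourhood \<Omega> W z"
proof -
  have "generate_topology_on {{z \<in> \<Omega>. \<phi> z \<in> U} | \<phi> U. plurisubharmonic_on \<Omega> \<phi> \<and> open U} W"
    using assms(2) by (simp add: pluri_fine_topology_def openin_topology_generated_by_iff)
  then show ?thesis using \<open>z \<in> W\<close>
  proof (induction arbitrary: z)
    case (Int a b)
    then show ?case by (auto intro: fine_neighbourhood_Int)
  next
    case (UN \<K>)
    then show ?case using fine_neighbourhood_mono by (meson Union_iff Union_upper)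
  next
    case (Basis s)
    then obtain \<phi> U where s: "s = {z \<in> \<Omega>. \<phi> z \<in> U}" "plurisubharmonic_on \<Omega> \<phi>" "open U" by auto
    have z: "z \<in> \<Omega>" "\<phi> z \<in> U" using Basis(2) s by auto
    have "\<phi> z < \<infinity>" using s(2) z(1) by (simp add: plurisubharmonic_on_def)
    \<comment> \<open>A neighbourhood of \<open>-\<infinity>\<close> contains a ray, so a sublevel
      set is enough there. At a finite value, the preimage of an interval is the intersection of a
      superlevel and a sublevel set.\<close>
    then consider (MInf) "\<phi> z = -\<infinity>" | (real) p where "\<phi> z = ereal p" by (cases "\<phi> z") auto
    then show ?case
    proof cases
      case MInf
      then obtain c where c: "{..<ereal c} \<subseteq> U" using open_MInfty2[OF \<open>open U\<close>] z(2) by auto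
      have "fine_neighbourhood \<Omega> {\<xi> \<in> \<Omega>. \<phi> \<xi> < ereal c} z"
        using MInf by (intro fine_neighbourhood_sublevel s(2) assms(1) z(1)) auto
      then show ?thesis by (rule fine_neighbourhood_mono) (use c s(1) in auto)
    next
      case (real p)
      have "open (ereal -` U)" using \<open>open U\<close> by (rule open_ereal_vimage)
      moreover have "p \<in> ereal -` U" using real z(2) by simp
      ultimately obtain \<epsilon> where \<epsilon>: "\<epsilon> > 0" "ball p \<epsilon> \<subseteq> ereal -` U" by (meson open_contains_ball)
      have inU: "x \<in> U" if "ereal (p - \<epsilon>) < x" "x < ereal (p + \<epsilon>)" for x
      proof (cases x)
        case (real q)
        then have "q \<in> ball p \<epsilon>" using that by (simp add: dist_real_def abs_less_iff)
        then show ?thesis using \<epsilon>(2) real by blast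
      qed (use that in auto)
      have "fine_neighbourhood \<Omega> ({\<xi> \<in> \<Omega>. ereal (p - \<epsilon>) < \<phi> \<xi>} \<inter> {\<xi> \<in> \<Omega>. \<phi> \<xi> < ereal (p + \<epsilon>)}) z"
        using real \<epsilon>(1)
        by (intro fine_neighbourhood_Int fine_neighbourhood_superlevel fine_neighbourhood_sublevel s(2) assms(1) z(1)) auto
      then show ?thesis by (rule fine_neighbourhood_mono) (use inU s(1) in auto)
    qed
  qed simp
qed

text \<open>The witness for \<open>\<eta> = 1/200\<close> is restricted to the line; dividing its
  radius by \<open>norm e\<close> converts distances into parameters.\<close>

lemma fine_disc_on_line:
  assumes "open \<Omega>" "openin (pluri_fine_topology \<Omega>) A" "a + \<zeta> *s e \<in> A" "e \<noteq> 0"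
  shows "\<exists>r. fine_disc {\<xi>. a + \<xi> *s e \<in> A} \<zeta> r"
proof -
  have "(0::real) < 1/200" by simp
  then obtain r v N where v: "r > 0" "pluri_superharmonic_on (ball (a + \<zeta> *s e) r) v"
    "{\<xi> \<in> ball (a + \<zeta> *s e) r. v \<xi> < 1} \<subseteq> A" "a + \<zeta> *s e \<in> N" "\<forall>\<xi>\<in>N. v \<xi> < ennreal (1/200)"
    using openin_pluri_fine_imp_fine_neighbourhood[OF assms(1-3)] unfolding fine_neighbourhood_def by meson
  define \<rho> where "\<rho> = r / norm e"
  have "\<rho> > 0" using v(1) \<open>e \<noteq> 0\<close> by (simp add: \<rho>_def)
  have sub: "a + \<xi> *s e \<in> ball (a + \<zeta> *s e) r" if "\<xi> \<in> ball \<zeta> \<rho>" for \<xi>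
  proof -
    have "(a + \<zeta> *s e) - (a + \<xi> *s e) = (\<zeta> - \<xi>) *s e" by (simp add: vec_eq_iff algebra_simps)
    then have "dist (a + \<zeta> *s e) (a + \<xi> *s e) = cmod (\<zeta> - \<xi>) * norm e"
      by (simp only: dist_norm norm_vector_scalar_mult)
    moreover have "cmod (\<zeta> - \<xi>) < r / norm e" using that by (simp add: \<rho>_def dist_norm)
    ultimately show ?thesis using \<open>e \<noteq> 0\<close> by (simp add: pos_less_divide_eq)
  qed
  have "superharmonic_on (ball \<zeta> \<rho>) (\<lambda>\<xi>. v (a + \<xi> *s e))"
    by (rule superharmonic_on_subset[OF pluri_superharmonic_on_line[OF v(2)]]) (use sub in auto)
  moreover have "{\<xi> \<in> ball \<zeta> \<rho>. v (a + \<xi> *s e) < 1} \<subseteq> {\<xi>. a + \<xi> *s e \<in> A}"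
    using sub v(3) by auto
  moreover have "v (a + \<zeta> *s e) < ennreal (1/200)" using v(4,5) by blast
  ultimately show ?thesis using \<open>\<rho> > 0\<close> unfolding fine_disc_def by blast
qed

text \<open>On the complex line through \<open>z0\<close> and \<open>z\<close> the witness is small
  at both points. They are joined by two segments inside its sublevel set, and neither segment can
  pass from one part of a separation of \<open>W\<close> to the other.\<close>

lemma pluri_fine_quasi_component_neighbourhood:
  assumes "open \<Omega>" "openin (pluri_fine_topology \<Omega>) W" "z0 \<in> W"
  shows "\<exists>N. openin (pluri_fine_topology \<Omega>) N \<and> z0 \<in> N \<and>
    N \<subseteq> quasi_component_of_set (subtopology (pluri_fine_topology \<Omega>) W) z0"
proof -
  let ?T = "pluri_fine_topology \<Omega>"
  have top: "topspace (subtopology ?T W) = W" using openin_subset[OF assms(2)] by auto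
  have "(0::real) < 1/200" by simp
  then obtain r v N where v: "r > 0" "ball z0 r \<subseteq> \<Omega>" "pluri_superharmonic_on (ball z0 r) v"
    "{\<xi> \<in> ball z0 r. v \<xi> < 1} \<subseteq> W" "openin ?T N" "z0 \<in> N" "\<forall>\<xi>\<in>N. v \<xi> < ennreal (1/200)"
    using openin_pluri_fine_imp_fine_neighbourhood[OF assms] unfolding fine_neighbourhood_def by meson
  \<comment> \<open>When the line is parametrised with \<open>z0\<close> at 0 and \<open>z\<close>
    at 1, the radius \<open>r/21\<close> keeps the disc of radius 21 about 0 inside
    \<open>ball z0 r\<close>. That disc contains the discs of radius 20 about 0 and 1 to which
    \<open>superharmonic_good_path\<close> is applied.\<close>
  define N' where "N' = N \<inter> ball z0 (r/21)"
  have small: "ennreal (1/200) < 1" using ennreal_less_iff[of "1/200" 1] by simp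
  have N'W: "N' \<subseteq> W"
  proof
    fix \<xi> assume \<xi>: "\<xi> \<in> N'"
    then have "v \<xi> < ennreal (1/200)" using v(7) by (simp add: N'_def)
    then have "v \<xi> < 1" using small by order
    moreover have "\<xi> \<in> ball z0 r" using \<xi> v(1) by (simp add: N'_def)
    ultimately show "\<xi> \<in> W" using v(4) by blast
  qed
  have "quasi_component_of (subtopology ?T W) z0 z" if z: "z \<in> N'" for z
  proof (cases "z = z0")
    case True
    then show ?thesis using \<open>z0 \<in> W\<close> top by simp
  next
    case False
    have "z \<in> W" using z N'W by blast
    show ?thesis
      unfolding quasi_component_of_alt
    proof (intro conjI notI)
      show "z0 \<in> topspace (subtopology ?T W)" "z \<in> topspace (subtopology ?T W)"
        using \<open>z0 \<in> W\<close> \<open>z \<in> W\<close> top by simp_all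
      assume "\<exists>U V. openin (subtopology ?T W) U \<and> openin (subtopology ?T W) V \<and>
         U \<union> V = topspace (subtopology ?T W) \<and> disjnt U V \<and> z0 \<in> U \<and> z \<in> V"
      then obtain A B where AB: "openin ?T A" "openin ?T B" "A \<union> B = W" "A \<inter> B = {}" "z0 \<in> A" "z \<in> B"
        unfolding top openin_open_subtopology[OF assms(2)] disjnt_def by blast
      define e where "e = z - z0"
      have e: "e \<noteq> 0" using False by (simp add: e_def)
      define L where "L \<zeta> = z0 + \<zeta> *s e" for \<zeta>
      have L01: "L 0 = z0" "L 1 = z" by (simp_all add: L_def e_def)
      define u where "u \<zeta> = v (L \<zeta>)" for \<zeta>
      have Lball: "L \<zeta> \<in> ball z0 r" if "\<zeta> \<in> ball 0 21" for \<zeta>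
      proof -
        have "norm e < r/21" using z by (simp add: N'_def e_def dist_norm norm_minus_commute)
        then have "cmod \<zeta> * norm e < 21 * (r/21)" using that e by (intro mult_strict_mono) auto
        then show ?thesis by (simp add: L_def dist_norm norm_vector_scalar_mult)
      qed
      have su: "superharmonic_on (ball 0 21) u"
        unfolding u_def L_def
        by (rule superharmonic_on_subset[OF pluri_superharmonic_on_line[OF v(3)]]) (use Lball in \<open>auto simp: L_def\<close>)
      have balls: "ball 0 20 \<subseteq> ball (0::complex) 21" "ball 1 20 \<subseteq> ball (0::complex) 21"
      proof -
        show "ball 1 20 \<subseteq> ball (0::complex) 21"
        proof
          fix \<zeta> :: complex assume "\<zeta> \<in> ball 1 20"
          then have "cmod (\<zeta> - 1) < 20" by (simp add: dist_norm norm_minus_commute)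
          then show "\<zeta> \<in> ball 0 21" using norm_triangle_ineq[of "\<zeta> - 1" 1] by simp
        qed
      qed auto
      have u0: "u 0 < ennreal (1/200)" "u 1 < ennreal (1/200)"
        using v(6,7) z by (auto simp: u_def L01 N'_def)
      obtain w where w: "closed_segment 0 w \<subseteq> {\<zeta> \<in> ball 0 20. u \<zeta> < 1}" "closed_segment 1 w \<subseteq> {\<zeta> \<in> ball 1 20. u \<zeta> < 1}"
        using superharmonic_good_path[of 0 20 u 1 u] superharmonic_on_subset[OF su] balls u0 by auto
      define A1 B1 where "A1 = {\<zeta>. L \<zeta> \<in> A}" and "B1 = {\<zeta>. L \<zeta> \<in> B}"
      have cover: "{\<zeta> \<in> ball 0 21. u \<zeta> < 1} \<subseteq> A1 \<union> B1"
        using Lball v(4) AB(3) by (auto simp: u_def A1_def B1_def)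
      have disj: "A1 \<inter> B1 = {}" using AB(4) by (auto simp: A1_def B1_def)
      have fA: "\<exists>r. fine_disc A1 \<zeta> r" if "\<zeta> \<in> A1" for \<zeta>
        using that fine_disc_on_line[OF assms(1) AB(1) _ e] by (auto simp: A1_def L_def)
      have fB: "\<exists>r. fine_disc B1 \<zeta> r" if "\<zeta> \<in> B1" for \<zeta>
        using that fine_disc_on_line[OF assms(1) AB(2) _ e] by (auto simp: B1_def L_def)
      have seg: "closed_segment 0 w \<subseteq> A1 \<union> B1" "closed_segment w 1 \<subseteq> A1 \<union> B1"
        using w cover balls unfolding closed_segment_commute[of w 1] by blast+
      have "w \<in> A1"
        by (rule closed_segment_finely_connected[OF disj fA fB seg(1)]) (use AB L01 in \<open>auto simp: A1_def\<close>)
      then have "1 \<in> A1"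
        using closed_segment_finely_connected[OF disj fA fB seg(2)] by blast
      then show False using AB(4,6) by (auto simp: A1_def L01)
    qed
  qed
  moreover have "openin ?T N'"
    unfolding N'_def using v(1,2) by (intro openin_Int v(5) openin_pluri_fine_ball) (auto intro: order_trans[rotated])
  moreover have "z0 \<in> N'" using v(1,6) by (simp add: N'_def)
  ultimately show ?thesis by blast
qed

theorem theorem1p1:
  fixes \<Omega> :: "(complex ^ 'n) set"
  assumes "open \<Omega>"
  shows "\<forall>z\<in>\<Omega>. locally_connected_at z (pluri_fine_topology \<Omega>)"
proof -
  have "locally_connected_space (pluri_fine_topology \<Omega>)"
    by (rule locally_connected_space_quasi_component) (rule pluri_fine_quasi_component_neighbourhood[OF assms])
  then show ?thesis
    unfolding locally_connected_space_alt neighbourhood_base_of_def locally_connected_at_def by simp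
qed

end
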